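(* Let $f$ be a cuspidal edge along a regular curve $\Gamma$ in $\mathbb L^3$. If a given cuspidal edge singular point $p:=(s,0)\in\Sigma_f$ is of order less than $4$ (i.e. $i_p\le3$), then umbilical points of $f$ never accumulate at $p$. Moreover, quasi-umbilical points of $f$ also cannot accumulate at $p$ unless $p$ is a light-like point (if $p$ is an isolated light-like point, quasi-umbilical points can accumulate at $p$).
   Context: $\mathbb L^3$ is $\mathbb R^3$ with $\langle a,b\rangle_L=a_1b_1+a_2b_2-a_3b_3$ and vector product $a\times_L b=E_3(a\times b)$, $E_3=\mathrm{diag}(1,1,-1)$; a vector $a\ne0$ is space-like, time-like or light-like if $\langle a,a\rangle_L$ is $>0$, $<0$ or $=0$. A generalized cuspidal edge along $\Gamma$ is a $C^\infty$-map $f:\mathcal U_f=I\times(-\delta,\delta)\to\mathbb R^3$ ($I$ an open interval, $\delta>0$) with $\Gamma(s)=f(s,0)$ a regular curve, $f_t(s,0)=0$, and $f_{tt}(s,0),\Gamma'(s)$ linearly independent for all $s\in I$; $\Sigma_f=\{(s,0):s\in I\}$. A point $(s,0)$ is a cuspidal edge singular point if near it $f$ is equivalent to $(s,t)\mapsto(s,t^2,t^3)$ at the origin under local diffeomorphisms of source and target. A cuspidal edge along $\Gamma$ is such a map all of whose points $(s,0)$ are cuspidal edge singular points (with coordinates chosen so that $f_t(s,0)=0$). The normal vector field is $\hat\nu^L(s,t)=f_s(s,t)\times_L\frac{f_t(s,t)}{t}$, extended smoothly to $t=0$, so $\hat\nu^L(s,0)=\Gamma'(s)\times_L f_{tt}(s,0)$.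 A point of $\mathcal U_f$ (singular points included) is space-like, time-like, light-like if $\hat\nu^L$ is time-like, space-like, light-like there. With $E^L=\langle f_s,f_s\rangle_L$, $F^L=\langle f_s,f_t\rangle_L$, $G^L=\langle f_t,f_t\rangle_L$, $\Delta_L=E^LG^L-(F^L)^2$, $\tilde L=\det(f_s,f_t,f_{ss})$, $\tilde M=\det(f_s,f_t,f_{st})$, $\tilde N=\det(f_s,f_t,f_{tt})$: a regular point is space-like (time-like) exactly when $\Delta_L>0$ ($<0$). The order $i_p$ of $p=(s,0)$ is the smallest $k$ with $\partial^k\Delta_L/\partial t^k(s,0)\ne0$ ($\infty$ if none). At space-like or time-like regular points, $W^L=\frac{1}{\Delta_L\sqrt{|\Delta_L|}}\begin{pmatrix}G^L&-F^L\\-F^L&E^L\end{pmatrix}\begin{pmatrix}\tilde L&\tilde M\\\tilde M&\tilde N\end{pmatrix}$, and the principal curvatures are its eigenvalues. An umbilical (resp. quasi-umbilical) point is a space-like or time-like regular point where the two principal curvatures coincide and $W^L$ is diagonal (resp. not diagonal).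
   Formalization: Here "p is a light-like point" (also in "isolated light-like point") means that the tangent vector Γ'(s) is light-like, instead of the normal vector at p; with the normal-vector meaning the quasi-umbilical claim is false. *)

theory Defs
  imports "HOL-Analysis.Analysis" "HOL-Library.Extended_Nat"
begin

section \<open>Smooth maps and local diffeomorphisms\<close>

(* Intended for open S only: derivatives are two-sided. *)
fun Ck_on :: "nat \<Rightarrow> 'a::real_normed_vector set \<Rightarrow> ('a \<Rightarrow> 'b::real_normed_vector) \<Rightarrow> bool" where
  "Ck_on 0 S f \<longleftrightarrow> continuous_on S f"
| "Ck_on (Suc k) S f \<longleftrightarrow>
     (\<forall>x\<in>S. f differentiable (at x)) \<and>
     (\<forall>v. Ck_on k S (\<lambda>x. frechet_derivative f (at x) v))"

definition smooth_on :: "'a::real_normed_vector set \<Rightarrow> ('a \<Rightarrow> 'b::real_normed_vector) \<Rightarrow> bool" where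
  "smooth_on S f \<longleftrightarrow> (\<forall>k. Ck_on k S f)"

definition diffeo_on ::
  "'a::real_normed_vector set \<Rightarrow> 'b::real_normed_vector set \<Rightarrow> ('a \<Rightarrow> 'b) \<Rightarrow> bool" where
  "diffeo_on U V \<phi> \<longleftrightarrow>
     open U \<and> open V \<and> smooth_on U \<phi> \<and> (\<exists>\<psi>. smooth_on V \<psi> \<and> homeomorphism U V \<phi> \<psi>)"


section \<open>The Lorentz-Minkowski space\<close>

definition inner_L :: "real^3 \<Rightarrow> real^3 \<Rightarrow> real" where
  "inner_L a b = a$1 * b$1 + a$2 * b$2 - a$3 * b$3"

definition E3 :: "real^3^3" where
  "E3 = vector [vector [1, 0, 0], vector [0, 1, 0], vector [0, 0, -1]]"

definition cross_L :: "real^3 \<Rightarrow> real^3 \<Rightarrow> real^3" where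
  "cross_L a b = E3 *v cross3 a b"

definition spacelike :: "real^3 \<Rightarrow> bool" where
  "spacelike a \<longleftrightarrow> a \<noteq> 0 \<and> inner_L a a > 0"

definition timelike :: "real^3 \<Rightarrow> bool" where
  "timelike a \<longleftrightarrow> a \<noteq> 0 \<and> inner_L a a < 0"

definition lightlike :: "real^3 \<Rightarrow> bool" where
  "lightlike a \<longleftrightarrow> a \<noteq> 0 \<and> inner_L a a = 0"

(* Not "independent {a, b}", which would hold for a = b \<noteq> 0. *)
definition lin_indep2 :: "'a::real_vector \<Rightarrow> 'a \<Rightarrow> bool" where
  "lin_indep2 a b \<longleftrightarrow> (\<forall>x y::real. x *\<^sub>R a + y *\<^sub>R b = 0 \<longrightarrow> x = 0 \<and> y = 0)"

(* Rows instead of columns: the same value, as a matrix and its transpose have equal determinants. *)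
definition det3 :: "real^3 \<Rightarrow> real^3 \<Rightarrow> real^3 \<Rightarrow> real" where
  "det3 a b c = det (vector [a, b, c] :: real^3^3)"


section \<open>Cuspidal edges\<close>

definition ds :: "(real \<times> real \<Rightarrow> real^3) \<Rightarrow> real \<times> real \<Rightarrow> real^3" where
  "ds f = (\<lambda>(s, t). vector_derivative (\<lambda>u. f (u, t)) (at s))"

definition dt :: "(real \<times> real \<Rightarrow> real^3) \<Rightarrow> real \<times> real \<Rightarrow> real^3" where
  "dt f = (\<lambda>(s, t). vector_derivative (\<lambda>u. f (s, u)) (at t))"

definition tangent :: "(real \<Rightarrow> real^3) \<Rightarrow> real \<Rightarrow> real^3" where
  "tangent \<Gamma> s = vector_derivative \<Gamma> (at s)"

definition strip :: "real set \<Rightarrow> real \<Rightarrow> (real \<times> real) set" where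
  "strip I \<delta> = I \<times> {-\<delta> <..< \<delta>}"

definition generalized_cuspidal_edge ::
  "real set \<Rightarrow> real \<Rightarrow> (real \<Rightarrow> real^3) \<Rightarrow> (real \<times> real \<Rightarrow> real^3) \<Rightarrow> bool" where
  "generalized_cuspidal_edge I \<delta> \<Gamma> f \<longleftrightarrow>
     I \<noteq> {} \<and> open I \<and> is_interval I \<and> \<delta> > 0 \<and> smooth_on (strip I \<delta>) f \<and>
     (\<forall>s\<in>I. \<Gamma> s = f (s, 0) \<and> tangent \<Gamma> s \<noteq> 0 \<and> dt f (s, 0) = 0 \<and>
            lin_indep2 (dt (dt f) (s, 0)) (tangent \<Gamma> s))"

definition standard_cusp :: "real \<times> real \<Rightarrow> real^3" where
  "standard_cusp = (\<lambda>(s, t). vector [s, t^2, t^3])"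

definition cuspidal_edge_singular_point ::
  "real set \<Rightarrow> real \<Rightarrow> (real \<times> real \<Rightarrow> real^3) \<Rightarrow> real \<times> real \<Rightarrow> bool" where
  "cuspidal_edge_singular_point I \<delta> f p \<longleftrightarrow>
     (\<exists>U V \<phi> A B \<Psi>.
        p \<in> U \<and> U \<subseteq> strip I \<delta> \<and> diffeo_on U V \<phi> \<and> \<phi> p = (0, 0) \<and>
        f ` U \<subseteq> A \<and> diffeo_on A B \<Psi> \<and> \<Psi> (f p) = 0 \<and>
        (\<forall>q\<in>U. \<Psi> (f q) = standard_cusp (\<phi> q)))"

definition cuspidal_edge ::
  "real set \<Rightarrow> real \<Rightarrow> (real \<Rightarrow> real^3) \<Rightarrow> (real \<times> real \<Rightarrow> real^3) \<Rightarrow> bool" where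
  "cuspidal_edge I \<delta> \<Gamma> f \<longleftrightarrow>
     generalized_cuspidal_edge I \<delta> \<Gamma> f \<and>
     (\<forall>s\<in>I. cuspidal_edge_singular_point I \<delta> f (s, 0))"

(* Light-like points (s, 0) in the sense of the singular curve: the tangent vector of \<Gamma>, not
   the normal vector of the surface, is light-like.  The two notions differ: a singular point
   with light-like normal vector may have a space-like tangent vector, and one with light-like
   tangent vector may have a space-like normal vector. *)
definition lightlike_curve_point :: "(real \<Rightarrow> real^3) \<Rightarrow> real \<Rightarrow> bool" where
  "lightlike_curve_point \<Gamma> s \<longleftrightarrow> lightlike (tangent \<Gamma> s)"

definition isolated_lightlike_curve_point :: "real set \<Rightarrow> (real \<Rightarrow> real^3) \<Rightarrow> real \<Rightarrow> bool" where
  "isolated_lightlike_curve_point I \<Gamma> s \<longleftrightarrow>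
     s \<in> I \<and> lightlike_curve_point \<Gamma> s \<and> \<not> s islimpt {u \<in> I. lightlike_curve_point \<Gamma> u}"


section \<open>Normal vector field and order\<close>

(* The value at t = 0 is the limit of the values at t \<noteq> 0, since f_t vanishes on t = 0. *)
definition nu_L :: "(real \<times> real \<Rightarrow> real^3) \<Rightarrow> real \<times> real \<Rightarrow> real^3" where
  "nu_L f = (\<lambda>(s, t). if t = 0 then cross_L (ds f (s, 0)) (dt (dt f) (s, 0))
                      else cross_L (ds f (s, t)) (dt f (s, t) /\<^sub>R t))"

definition spacelike_point :: "(real \<times> real \<Rightarrow> real^3) \<Rightarrow> real \<times> real \<Rightarrow> bool" where
  "spacelike_point f p \<longleftrightarrow> timelike (nu_L f p)"

definition timelike_point :: "(real \<times> real \<Rightarrow> real^3) \<Rightarrow> real \<times> real \<Rightarrow> bool" where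
  "timelike_point f p \<longleftrightarrow> spacelike (nu_L f p)"

definition regular_point :: "(real \<times> real \<Rightarrow> real^3) \<Rightarrow> real \<times> real \<Rightarrow> bool" where
  "regular_point f p \<longleftrightarrow> lin_indep2 (ds f p) (dt f p)"

definition E_L :: "(real \<times> real \<Rightarrow> real^3) \<Rightarrow> real \<times> real \<Rightarrow> real" where
  "E_L f p = inner_L (ds f p) (ds f p)"

definition F_L :: "(real \<times> real \<Rightarrow> real^3) \<Rightarrow> real \<times> real \<Rightarrow> real" where
  "F_L f p = inner_L (ds f p) (dt f p)"

definition G_L :: "(real \<times> real \<Rightarrow> real^3) \<Rightarrow> real \<times> real \<Rightarrow> real" where
  "G_L f p = inner_L (dt f p) (dt f p)"

definition Delta_L :: "(real \<times> real \<Rightarrow> real^3) \<Rightarrow> real \<times> real \<Rightarrow> real" where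
  "Delta_L f p = E_L f p * G_L f p - (F_L f p)^2"

(* The infimum of the empty set is \<infinity>. *)
definition sing_order :: "(real \<times> real \<Rightarrow> real^3) \<Rightarrow> real \<Rightarrow> enat" where
  "sing_order f s = (INF k\<in>{k. (deriv ^^ k) (\<lambda>t. Delta_L f (s, t)) 0 \<noteq> 0}. enat k)"


section \<open>Umbilical and quasi-umbilical points\<close>

definition L_tilde :: "(real \<times> real \<Rightarrow> real^3) \<Rightarrow> real \<times> real \<Rightarrow> real" where
  "L_tilde f p = det3 (ds f p) (dt f p) (ds (ds f) p)"

definition M_tilde :: "(real \<times> real \<Rightarrow> real^3) \<Rightarrow> real \<times> real \<Rightarrow> real" where
  "M_tilde f p = det3 (ds f p) (dt f p) (dt (ds f) p)"

definition N_tilde :: "(real \<times> real \<Rightarrow> real^3) \<Rightarrow> real \<times> real \<Rightarrow> real" where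
  "N_tilde f p = det3 (ds f p) (dt f p) (dt (dt f) p)"

definition W_L :: "(real \<times> real \<Rightarrow> real^3) \<Rightarrow> real \<times> real \<Rightarrow> real^2^2" where
  "W_L f p = (1 / (Delta_L f p * sqrt \<bar>Delta_L f p\<bar>)) *\<^sub>R
     ((vector [vector [G_L f p, - F_L f p], vector [- F_L f p, E_L f p]] :: real^2^2) **
      (vector [vector [L_tilde f p, M_tilde f p], vector [M_tilde f p, N_tilde f p]] :: real^2^2))"

(* Complex eigenvalues, since at time-like points the two principal curvatures may be a pair of
   non-real conjugates.  They coincide iff this set has a single element. *)
definition principal_curvatures :: "(real \<times> real \<Rightarrow> real^3) \<Rightarrow> real \<times> real \<Rightarrow> complex set" where
  "principal_curvatures f p =
     {k. \<exists>v::complex^2. v \<noteq> 0 \<and> (\<chi> i j. complex_of_real (W_L f p $ i $ j)) *v v = k *s v}"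

definition umbilical_points :: "real set \<Rightarrow> real \<Rightarrow> (real \<times> real \<Rightarrow> real^3) \<Rightarrow> (real \<times> real) set" where
  "umbilical_points I \<delta> f =
     {p \<in> strip I \<delta>. regular_point f p \<and> (spacelike_point f p \<or> timelike_point f p) \<and>
        is_singleton (principal_curvatures f p) \<and>
        (W_L f p $ 1 $ 2 = 0 \<and> W_L f p $ 2 $ 1 = 0)}"

definition quasi_umbilical_points :: "real set \<Rightarrow> real \<Rightarrow> (real \<times> real \<Rightarrow> real^3) \<Rightarrow> (real \<times> real) set" where
  "quasi_umbilical_points I \<delta> f =
     {p \<in> strip I \<delta>. regular_point f p \<and> (spacelike_point f p \<or> timelike_point f p) \<and>
        is_singleton (principal_curvatures f p) \<and>
        \<not> (W_L f p $ 1 $ 2 = 0 \<and> W_L f p $ 2 $ 1 = 0)}"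

end

theory Submission
  imports Defs
begin

text \<open>
  Near a point \<open>(s, 0)\<close> of the singular curve everything is governed by powers of \<open>t\<close>.
  Since \<open>f_t\<close> vanishes for \<open>t = 0\<close>, so does \<open>f_st\<close> (the mixed partial derivatives commute:
  \<open>mixed_partials_commute\<close>), and as \<open>t\<close> tends to 0 off the singular curve

    \<open>E \<rightarrow> e, F / t \<rightarrow> \<phi>, G / t^2 \<rightarrow> \<gamma>, L \<rightarrow> 0, M / t \<rightarrow> 0, N / t^2 \<rightarrow> n\<close>

  where \<open>e = \<langle>\<Gamma>', \<Gamma>'\<rangle>\<close>, \<open>\<phi> = \<langle>\<Gamma>', f_tt\<rangle>\<close>, \<open>\<gamma> = \<langle>f_tt, f_tt\<rangle>\<close> and
  \<open>n = det (\<Gamma>', f_tt, f_ttt) / 2\<close>. At a cuspidal edge singular point \<open>n \<noteq> 0\<close>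
  (\<open>cuspidal_edge_singular_point_nondegenerate\<close>).

  The principal curvatures coincide exactly when
  \<open>(G L - E N)^2 + 4 (G M - F N) (E M - F L) = 0\<close>. Divided by \<open>t^4\<close>, the left side
  tends to \<open>(e n)^2\<close>. Hence umbilical or quasi-umbilical points can accumulate only where \<open>e = 0\<close>, that is,
  where the tangent vector of \<open>\<Gamma>\<close> is light-like. At umbilical points also \<open>G M - F N = 0\<close>; divided
  by \<open>t^3\<close>, this tends to \<open>- \<phi> n\<close>, so where umbilical points accumulate \<open>\<phi> = 0\<close> too.
  But \<open>e = \<phi> = 0\<close> makes each of \<open>E\<close>, \<open>F\<close>, \<open>G\<close> vanish to second order along \<open>t\<close>, so that
  \<open>E G - F^2\<close> vanishes to fourth order and the order of the point is at least 4 (\<open>sing_order_ge_4\<close>).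

  For the existence part take \<open>f (s, t) = (s, s^2/2 + t^3/3, s + t^2/2)\<close>, whose tangent vector
  \<open>(1, s, 1)\<close> along the edge is light-like only at \<open>s = 0\<close>. Up to the factor \<open>t^4\<close> the expression above is
  \<open>(t - t^3 + s^2)^2 + 4 t (s t - 1)^2\<close>. It is positive at \<open>t = 0\<close> and negative at
  \<open>t = - s^2\<close> for small \<open>s > 0\<close>, so it has zeros arbitrarily close to the origin, and these are
  quasi-umbilical points because umbilical points do not accumulate there.
\<close>

section \<open>Calculus of smooth maps\<close>

lemma Ck_on_cong:
  assumes "open S" "\<And>x. x \<in> S \<Longrightarrow> f x = g x" "Ck_on k S f"
  shows "Ck_on k S g"
  using assms(2,3)
proof (induction k arbitrary: f g)
  case 0
  then show ?case by (simp cong: continuous_on_cong)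
next
  case (Suc k)
  have d: "(g has_derivative frechet_derivative f (at x)) (at x)" if "x \<in> S" for x
    using Suc.prems that assms(1)
    by (meson Ck_on.simps(2) frechet_derivative_works has_derivative_transform_within_open)
  then have "frechet_derivative g (at x) = frechet_derivative f (at x)" if "x \<in> S" for x
    using frechet_derivative_at that by metis
  then have "Ck_on k S (\<lambda>x. frechet_derivative g (at x) v)" for v
    using Suc.IH[of "\<lambda>x. frechet_derivative f (at x) v" "\<lambda>x. frechet_derivative g (at x) v"] Suc.prems(2)
    by simp
  with d show ?case by (auto simp: differentiable_def)
qed

lemma Ck_on_Suc_imp_Ck_on: "Ck_on (Suc k) S f \<Longrightarrow> Ck_on k S f"
proof (induction k arbitrary: f)
  case 0
  then show ?case
    by (auto intro!: differentiable_imp_continuous_on differentiable_at_imp_differentiable_on)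
next
  case (Suc k)
  then show ?case
    using Ck_on.simps(2)[of "Suc k" S f] Ck_on.simps(2)[of k S f] by blast
qed

text \<open>Lets smoothness be checked with any known formula for the derivative in place of the chosen one.\<close>
lemma Ck_on_SucI:
  assumes "open S" and "\<And>x. x \<in> S \<Longrightarrow> (f has_derivative D x) (at x)"
    and "\<And>v. Ck_on k S (\<lambda>x. D x v)"
  shows "Ck_on (Suc k) S f"
proof -
  have "D x = frechet_derivative f (at x)" if "x \<in> S" for x
    using frechet_derivative_at assms(2) that by blast
  then have "Ck_on k S (\<lambda>x. frechet_derivative f (at x) v)" for v
    by (intro Ck_on_cong[OF assms(1) _ assms(3)[of v]]) simp
  then show ?thesis using assms(2) by (auto simp: differentiable_def)
qed

lemma Ck_on_const: "open S \<Longrightarrow> Ck_on k S (\<lambda>x. c)"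
  by (induction k arbitrary: c) auto

lemma Ck_on_add:
  assumes "open S" "Ck_on k S f" "Ck_on k S g"
  shows "Ck_on k S (\<lambda>x. f x + g x)"
  using assms(2,3)
proof (induction k arbitrary: f g)
  case 0
  then show ?case by (simp add: continuous_on_add)
next
  case (Suc k)
  show ?case
  proof (intro Ck_on_SucI[OF assms(1)])
    show "((\<lambda>x. f x + g x) has_derivative
      (\<lambda>h. frechet_derivative f (at x) h + frechet_derivative g (at x) h)) (at x)" if "x \<in> S" for x
      using Suc.prems that by (intro has_derivative_add) (auto simp: frechet_derivative_works[symmetric])
    show "Ck_on k S (\<lambda>x. frechet_derivative f (at x) v + frechet_derivative g (at x) v)" for v
      using Suc.prems by (intro Suc.IH) auto
  qed
qed

lemma (in bounded_bilinear) Ck_on: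
  assumes "open S" "Ck_on k S f" "Ck_on k S g"
  shows "Ck_on k S (\<lambda>x. prod (f x) (g x))"
  using assms(2,3)
proof (induction k arbitrary: f g)
  case 0
  then show ?case by (simp add: continuous_on)
next
  case (Suc k)
  show ?case
  proof (intro Ck_on_SucI[OF assms(1)])
    show "((\<lambda>x. prod (f x) (g x)) has_derivative
      (\<lambda>h. prod (f x) (frechet_derivative g (at x) h) + prod (frechet_derivative f (at x) h) (g x))) (at x)"
      if "x \<in> S" for x
      using Suc.prems that by (intro FDERIV) (auto simp: frechet_derivative_works[symmetric])
    show "Ck_on k S (\<lambda>x. prod (f x) (frechet_derivative g (at x) v) + prod (frechet_derivative f (at x) v) (g x))" for v
      using Suc.prems Ck_on_Suc_imp_Ck_on[OF Suc.prems(1)] Ck_on_Suc_imp_Ck_on[OF Suc.prems(2)]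
      by (intro Ck_on_add[OF assms(1)] Suc.IH) auto
  qed
qed

lemma smooth_on_bounded_linear:
  assumes "open S" "bounded_linear f"
  shows "smooth_on S f"
proof -
  have "Ck_on k S f" for k
  proof (cases k)
    case 0
    then show ?thesis using assms by (simp add: linear_continuous_on)
  next
    case (Suc n)
    show ?thesis unfolding Suc
      by (rule Ck_on_SucI[where D="\<lambda>_. f"])
         (use assms in \<open>auto intro: bounded_linear_imp_has_derivative Ck_on_const\<close>)
  qed
  then show ?thesis by (simp add: smooth_on_def)
qed

lemma smooth_on_const: "open S \<Longrightarrow> smooth_on S (\<lambda>x. c)"
  by (simp add: smooth_on_def Ck_on_const)

lemma smooth_on_add:
  "open S \<Longrightarrow> smooth_on S f \<Longrightarrow> smooth_on S g \<Longrightarrow> smooth_on S (\<lambda>x. f x + g x)"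
  by (simp add: smooth_on_def Ck_on_add)

lemma smooth_on_scaleR:
  "open S \<Longrightarrow> smooth_on S f \<Longrightarrow> smooth_on S g \<Longrightarrow> smooth_on S (\<lambda>x. f x *\<^sub>R g x)"
  by (simp add: smooth_on_def bounded_bilinear.Ck_on[OF bounded_bilinear_scaleR])

lemma smooth_on_mult:
  fixes f g :: "_ \<Rightarrow> real"
  shows "open S \<Longrightarrow> smooth_on S f \<Longrightarrow> smooth_on S g \<Longrightarrow> smooth_on S (\<lambda>x. f x * g x)"
  using smooth_on_scaleR[of S f g] by simp

lemma vector_3_eq_axis:
  "(vector [x, y, z] :: real^3) = x *\<^sub>R axis 1 1 + (y *\<^sub>R axis 2 1 + z *\<^sub>R axis 3 1)"
  by (simp add: vec_eq_iff forall_3 axis_def)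

lemma smooth_on_vector_3:
  assumes "open S" "smooth_on S x" "smooth_on S y" "smooth_on S z"
  shows "smooth_on S (\<lambda>p. vector [x p, y p, z p] :: real^3)"
  unfolding vector_3_eq_axis
  using assms by (intro smooth_on_add smooth_on_scaleR smooth_on_const)

lemma smooth_on_cong:
  "open S \<Longrightarrow> (\<And>x. x \<in> S \<Longrightarrow> f x = g x) \<Longrightarrow> smooth_on S f \<Longrightarrow> smooth_on S g"
  using Ck_on_cong unfolding smooth_on_def by metis

lemma smooth_on_imp_frechet_derivative:
  "smooth_on S f \<Longrightarrow> x \<in> S \<Longrightarrow> (f has_derivative frechet_derivative f (at x)) (at x)"
  using Ck_on.simps(2)[of 0 S f] by (auto simp: smooth_on_def frechet_derivative_works[symmetric] simp del: Ck_on.simps)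

lemma smooth_on_imp_continuous_on: "smooth_on S f \<Longrightarrow> continuous_on S f"
  using Ck_on.simps(1) by (auto simp: smooth_on_def simp del: Ck_on.simps)

lemma smooth_on_frechet_derivative:
  "smooth_on S f \<Longrightarrow> smooth_on S (\<lambda>x. frechet_derivative f (at x) v)"
  unfolding smooth_on_def using Ck_on.simps(2) by blast


section \<open>Partial derivatives\<close>

lemma open_strip: "open I \<Longrightarrow> open (strip I \<delta>)"
  by (simp add: strip_def open_Times)

lemma has_vector_derivative_along_s:
  assumes "smooth_on S f" "(s, t) \<in> S"
  shows "((\<lambda>u. f (u, t)) has_vector_derivative frechet_derivative f (at (s, t)) (1, 0)) (at s)"
proof -
  note d = smooth_on_imp_frechet_derivative[OF assms]
  have "((\<lambda>u. f (u, t)) has_derivative (\<lambda>h. frechet_derivative f (at (s, t)) (h, 0))) (at s)"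
    by (rule has_derivative_compose[of "\<lambda>u. (u, t)" "\<lambda>h. (h, 0)" s UNIV f, simplified])
       (auto intro!: derivative_eq_intros d)
  moreover have "(\<lambda>h. frechet_derivative f (at (s, t)) (h, 0)) = (\<lambda>h. h *\<^sub>R frechet_derivative f (at (s, t)) (1, 0))"
  proof
    show "frechet_derivative f (at (s, t)) (h, 0) = h *\<^sub>R frechet_derivative f (at (s, t)) (1, 0)" for h
      using linear_cmul[OF has_derivative_linear[OF d], of h "(1, 0)"] by simp
  qed
  ultimately show ?thesis unfolding has_vector_derivative_def by argo
qed

lemma has_vector_derivative_along_t:
  assumes "smooth_on S f" "(s, t) \<in> S"
  shows "((\<lambda>u. f (s, u)) has_vector_derivative frechet_derivative f (at (s, t)) (0, 1)) (at t)"
proof -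
  note d = smooth_on_imp_frechet_derivative[OF assms]
  have "((\<lambda>u. f (s, u)) has_derivative (\<lambda>h. frechet_derivative f (at (s, t)) (0, h))) (at t)"
    by (rule has_derivative_compose[of "\<lambda>u. (s, u)" "\<lambda>h. (0, h)" t UNIV f, simplified])
       (auto intro!: derivative_eq_intros d)
  moreover have "(\<lambda>h. frechet_derivative f (at (s, t)) (0, h)) = (\<lambda>h. h *\<^sub>R frechet_derivative f (at (s, t)) (0, 1))"
  proof
    show "frechet_derivative f (at (s, t)) (0, h) = h *\<^sub>R frechet_derivative f (at (s, t)) (0, 1)" for h
      using linear_cmul[OF has_derivative_linear[OF d], of h "(0, 1)"] by simp
  qed
  ultimately show ?thesis unfolding has_vector_derivative_def by argo
qed

lemma ds_eq_frechet_derivative: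
  "smooth_on S f \<Longrightarrow> p \<in> S \<Longrightarrow> ds f p = frechet_derivative f (at p) (1, 0)"
  unfolding ds_def using has_vector_derivative_along_s[of S f "fst p" "snd p"]
  by (auto intro: vector_derivative_at split: prod.splits)

lemma dt_eq_frechet_derivative:
  "smooth_on S f \<Longrightarrow> p \<in> S \<Longrightarrow> dt f p = frechet_derivative f (at p) (0, 1)"
  unfolding dt_def using has_vector_derivative_along_t[of S f "fst p" "snd p"]
  by (auto intro: vector_derivative_at split: prod.splits)

lemma smooth_on_ds: "open S \<Longrightarrow> smooth_on S f \<Longrightarrow> smooth_on S (ds f)"
  by (rule smooth_on_cong[OF _ _ smooth_on_frechet_derivative]) (auto simp: ds_eq_frechet_derivative)

lemma smooth_on_dt: "open S \<Longrightarrow> smooth_on S f \<Longrightarrow> smooth_on S (dt f)"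
  by (rule smooth_on_cong[OF _ _ smooth_on_frechet_derivative]) (auto simp: dt_eq_frechet_derivative)

lemma has_vector_derivative_ds:
  "smooth_on S f \<Longrightarrow> (s, t) \<in> S \<Longrightarrow> ((\<lambda>u. f (u, t)) has_vector_derivative ds f (s, t)) (at s)"
  using has_vector_derivative_along_s ds_eq_frechet_derivative by metis

lemma has_vector_derivative_dt:
  "smooth_on S f \<Longrightarrow> (s, t) \<in> S \<Longrightarrow> ((\<lambda>u. f (s, u)) has_vector_derivative dt f (s, t)) (at t)"
  using has_vector_derivative_along_t dt_eq_frechet_derivative by metis

lemma smooth_on_isCont: "open S \<Longrightarrow> smooth_on S f \<Longrightarrow> p \<in> S \<Longrightarrow> isCont f p"
  using smooth_on_imp_continuous_on continuous_on_eq_continuous_at by blast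

lemma norm_diff_le_vector_derivative:
  fixes f :: "real \<Rightarrow> 'b::real_normed_vector"
  assumes "convex T" "\<And>x. x \<in> T \<Longrightarrow> (f has_vector_derivative f' x) (at x)"
    "\<And>x. x \<in> T \<Longrightarrow> norm (f' x) \<le> B" "x \<in> T" "y \<in> T"
  shows "norm (f x - f y) \<le> B * \<bar>x - y\<bar>"
proof -
  have "norm (f x - f y) \<le> B * norm (x - y)"
  proof (rule differentiable_bound[OF assms(1) _ _ assms(4,5)])
    show "(f has_derivative (\<lambda>h. h *\<^sub>R f' x)) (at x within T)" if "x \<in> T" for x
      using assms(2)[OF that] has_derivative_at_withinI unfolding has_vector_derivative_def by blast
    show "onorm (\<lambda>h. h *\<^sub>R f' x) \<le> B" if "x \<in> T" for x
      using assms(3)[OF that]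
      by (intro onorm_le) (simp add: mult.commute[of B] mult_left_mono)
  qed
  then show ?thesis by simp
qed

lemma box_in_open:
  fixes s t :: real
  assumes "open S" "(s, t) \<in> S"
  obtains d where "d > 0" "\<And>a b. \<bar>a - s\<bar> < d \<Longrightarrow> \<bar>b - t\<bar> < d \<Longrightarrow> (a, b) \<in> S"
proof -
  obtain A B where AB: "open A" "open B" "(s, t) \<in> A \<times> B" "A \<times> B \<subseteq> S"
    using open_prod_elim[OF assms] by blast
  then obtain d e where "d > 0" "ball s d \<subseteq> A" "e > 0" "ball t e \<subseteq> B"
    by (metis SigmaE2 open_contains_ball)
  then show ?thesis
    using AB(4) by (intro that[of "min d e"]) (auto simp: subset_iff ball_def dist_real_def abs_minus_commute)
qed

text \<open>Continuity at a point in terms of coordinate boxes, in which both coordinate segments through a point stay.\<close>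
lemma isCont_box:
  fixes h :: "real \<times> real \<Rightarrow> 'b::metric_space"
  assumes "open S" "(s, t) \<in> S" "isCont h (s, t)" "e > 0"
  obtains d where "d > 0"
    "\<And>a b. \<bar>a - s\<bar> < d \<Longrightarrow> \<bar>b - t\<bar> < d \<Longrightarrow> (a, b) \<in> S \<and> dist (h (a, b)) (h (s, t)) < e"
proof -
  have "(h \<longlongrightarrow> h (s, t)) (nhds (s, t))"
    using assms(3) by (simp add: isCont_def tendsto_at_iff_tendsto_nhds)
  then have "eventually (\<lambda>q. q \<in> S \<and> dist (h q) (h (s, t)) < e) (nhds (s, t))"
    using eventually_nhds_in_open[OF assms(1,2)] tendstoD[OF _ \<open>e > 0\<close>] eventually_conj by blast
  then obtain T where "open T" "(s, t) \<in> T" "\<forall>q\<in>T. q \<in> S \<and> dist (h q) (h (s, t)) < e"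
    by (auto simp: eventually_nhds)
  then show ?thesis using box_in_open[of T s t] that by metis
qed

lemma has_vector_derivative_quotient_tendsto:
  assumes "(f has_vector_derivative D) (at x)"
  shows "((\<lambda>y. (f y - f x) /\<^sub>R (y - x)) \<longlongrightarrow> D) (at x)"
proof -
  have "((\<lambda>y. norm (f y - f x - (y - x) *\<^sub>R D) / norm (y - x)) \<longlongrightarrow> 0) (at x)"
    using assms by (simp add: has_vector_derivative_def has_derivative_iff_norm)
  then have "((\<lambda>y. norm ((f y - f x) /\<^sub>R (y - x) - D)) \<longlongrightarrow> 0) (at x)"
  proof (rule Lim_transform_eventually)
    show "\<forall>\<^sub>F y in at x. norm (f y - f x - (y - x) *\<^sub>R D) / norm (y - x)
        = norm ((f y - f x) /\<^sub>R (y - x) - D)"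
      unfolding eventually_at_filter
    proof (intro always_eventually allI impI)
      fix y assume "y \<noteq> x"
      then have "(f y - f x) /\<^sub>R (y - x) - D = (f y - f x - (y - x) *\<^sub>R D) /\<^sub>R (y - x)"
        by (simp add: scaleR_diff_right)
      then show "norm (f y - f x - (y - x) *\<^sub>R D) / norm (y - x) = norm ((f y - f x) /\<^sub>R (y - x) - D)"
        by (simp add: divide_inverse_commute)
    qed
  qed
  then show ?thesis using Lim_null tendsto_norm_zero_iff by blast
qed

text \<open>The second difference of \<open>f\<close> over a small rectangle is, by two applications of the mean value inequality,
  close to its area times \<open>\<partial>\<^sub>t \<partial>\<^sub>s f\<close>. Dividing by the height and letting it tend to 0 turns it into the first
  difference of \<open>\<partial>\<^sub>t f\<close>, which is therefore differentiable in \<open>s\<close> with derivative \<open>\<partial>\<^sub>t \<partial>\<^sub>s f\<close>.\<close>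
lemma mixed_partials_commute:
  assumes S: "open S" and f: "smooth_on S f" and p: "(s, t) \<in> S"
  shows "dt (ds f) (s, t) = ds (dt f) (s, t)"
proof -
  define w where "w = dt (ds f) (s, t)"
  note fs = smooth_on_ds[OF S f] and ft = smooth_on_dt[OF S f]
  have "((\<lambda>u. dt f (u, t)) has_vector_derivative w) (at s)"
    unfolding has_vector_derivative_def has_derivative_at_alt
  proof (intro conjI bounded_linear_scaleR_left allI impI)
    fix e :: real assume "e > 0"
    obtain d where d: "d > 0"
      "\<And>a b. \<bar>a - s\<bar> < d \<Longrightarrow> \<bar>b - t\<bar> < d \<Longrightarrow> (a, b) \<in> S \<and> dist (dt (ds f) (a, b)) w < e"
      using isCont_box[OF S p smooth_on_isCont[OF S smooth_on_dt[OF S fs] p] \<open>e > 0\<close>] 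
      unfolding w_def by metis
    (* The second difference of f differs from (a - s) (b - t) w by at most e |a - s| |b - t|. *)
    have *: "norm ((f (a, b) - f (a, t)) - (f (s, b) - f (s, t)) - ((a - s) * (b - t)) *\<^sub>R w)
        \<le> e * \<bar>b - t\<bar> * \<bar>a - s\<bar>" if "\<bar>a - s\<bar> < d" "\<bar>b - t\<bar> < d" for a b
    proof -
      have 1: "norm (ds f (x, b) - ds f (x, t) - (b - t) *\<^sub>R w) \<le> e * \<bar>b - t\<bar>" if "\<bar>x - s\<bar> < d" for x
      proof -
        have "norm ((ds f (x, b) - b *\<^sub>R w) - (ds f (x, t) - t *\<^sub>R w)) \<le> e * \<bar>b - t\<bar>"
          by (rule norm_diff_le_vector_derivative[where T="ball t d" and f'="\<lambda>y. dt (ds f) (x, y) - w"])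
             (use that d \<open>\<bar>b - t\<bar> < d\<close> in \<open>auto simp: dist_norm abs_minus_commute intro!: derivative_eq_intros has_vector_derivative_dt[OF fs] less_imp_le\<close>)
        then show ?thesis by (simp add: algebra_simps)
      qed
      have "norm ((f (a, b) - f (a, t) - (a * (b - t)) *\<^sub>R w) - (f (s, b) - f (s, t) - (s * (b - t)) *\<^sub>R w))
        \<le> e * \<bar>b - t\<bar> * \<bar>a - s\<bar>"
        by (rule norm_diff_le_vector_derivative[where T="ball s d" and f'="\<lambda>x. ds f (x, b) - ds f (x, t) - (b - t) *\<^sub>R w"])
             (use that d 1 in \<open>auto simp: dist_norm abs_minus_commute intro!: derivative_eq_intros has_vector_derivative_ds[OF f] less_imp_le\<close>)
      then show ?thesis by (simp add: algebra_simps)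
    qed
    have "norm (dt f (a, t) - dt f (s, t) - (a - s) *\<^sub>R w) \<le> e * norm (a - s)" if a: "\<bar>a - s\<bar> < d" for a
    proof -
      have lim: "((\<lambda>b. (f (x, b) - f (x, t)) /\<^sub>R (b - t)) \<longlongrightarrow> dt f (x, t)) (at t)" if "\<bar>x - s\<bar> < d" for x
        using has_vector_derivative_quotient_tendsto[OF has_vector_derivative_dt[OF f, of x t]] d that by auto
      have "((\<lambda>b. norm ((f (a, b) - f (a, t)) /\<^sub>R (b - t) - (f (s, b) - f (s, t)) /\<^sub>R (b - t) - (a - s) *\<^sub>R w))
          \<longlongrightarrow> norm (dt f (a, t) - dt f (s, t) - (a - s) *\<^sub>R w)) (at t)"
        using a d by (intro tendsto_intros lim) auto
      moreover have "\<forall>\<^sub>F b in at t. norm ((f (a, b) - f (a, t)) /\<^sub>R (b - t) - (f (s, b) - f (s, t)) /\<^sub>R (b - t) - (a - s) *\<^sub>R w) \<le> e * \<bar>a - s\<bar>"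
        unfolding eventually_at
      proof (intro exI[of _ d] conjI ballI impI d)
        fix b assume b: "b \<noteq> t \<and> dist b t < d"
        define X where "X = (f (a, b) - f (a, t)) - (f (s, b) - f (s, t)) - ((a - s) * (b - t)) *\<^sub>R w"
        have "(f (a, b) - f (a, t)) /\<^sub>R (b - t) - (f (s, b) - f (s, t)) /\<^sub>R (b - t) - (a - s) *\<^sub>R w
          = X /\<^sub>R (b - t)"
          using b by (simp add: X_def scaleR_diff_right[of "inverse (b - t)"])
        moreover have "norm X \<le> e * \<bar>b - t\<bar> * \<bar>a - s\<bar>"
          using *[OF a, of b] b by (simp add: X_def dist_real_def)
        ultimately show "norm ((f (a, b) - f (a, t)) /\<^sub>R (b - t) - (f (s, b) - f (s, t)) /\<^sub>R (b - t) - (a - s) *\<^sub>R w) \<le> e * \<bar>a - s\<bar>"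
          using b by (simp add: divide_simps mult_ac)
      qed
      ultimately show ?thesis by (auto intro: tendsto_upperbound)
    qed
    then show "\<exists>d>0. \<forall>y. norm (y - s) < d \<longrightarrow> norm (dt f (y, t) - dt f (s, t) - (y - s) *\<^sub>R w) \<le> e * norm (y - s)"
      using d(1) by (intro exI[of _ d]) auto
  qed
  then show ?thesis
    using has_vector_derivative_ds[OF ft p] vector_derivative_unique_at unfolding w_def by blast
qed

section \<open>Limits of divided differences\<close>

lemma norm_le_power_of_vector_derivative:
  fixes h :: "real \<Rightarrow> 'b::real_normed_vector"
  assumes "\<And>y. \<bar>y\<bar> \<le> \<bar>t\<bar> \<Longrightarrow> (h has_vector_derivative h' y) (at y)"
    and "\<And>y. \<bar>y\<bar> \<le> \<bar>t\<bar> \<Longrightarrow> norm (h' y) \<le> e * \<bar>y\<bar> ^ n"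
    and "h 0 = 0" "e \<ge> 0"
  shows "norm (h t) \<le> e * \<bar>t\<bar> ^ Suc n"
proof -
  have "norm (h t - h 0) \<le> e * \<bar>t\<bar> ^ n * \<bar>t - 0\<bar>"
  proof (rule norm_diff_le_vector_derivative[where T="{-\<bar>t\<bar>..\<bar>t\<bar>}" and f'=h'])
    fix y assume "y \<in> {-\<bar>t\<bar>..\<bar>t\<bar>}"
    then have y: "\<bar>y\<bar> \<le> \<bar>t\<bar>" by auto
    then show "(h has_vector_derivative h' y) (at y)" using assms(1) by blast
    have "e * \<bar>y\<bar> ^ n \<le> e * \<bar>t\<bar> ^ n"
      using y \<open>e \<ge> 0\<close> by (intro mult_left_mono power_mono) auto
    then show "norm (h' y) \<le> e * \<bar>t\<bar> ^ n" using assms(2)[OF y] by linarith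
  qed auto
  then show ?thesis using assms(3) by (simp add: mult_ac)
qed

text \<open>A vector-valued l'Hopital rule for quotients by powers: subtract the expected leading term and
  integrate the bound on the derivative of the difference.\<close>
lemma lhopital_power_vector:
  fixes h :: "real \<Rightarrow> 'b::real_normed_vector"
  assumes "d > 0" and h: "\<And>t. \<bar>t\<bar> < d \<Longrightarrow> (h has_vector_derivative h' t) (at t)"
    and "h 0 = 0" "h' 0 = 0"
    and lim: "((\<lambda>t. h' t /\<^sub>R t ^ Suc n) \<longlongrightarrow> w) (at 0)"
  shows "((\<lambda>t. h t /\<^sub>R t ^ Suc (Suc n)) \<longlongrightarrow> w /\<^sub>R real (Suc (Suc n))) (at 0)"
proof (rule tendstoI)
  fix e :: real assume "e > 0"
  then have "\<forall>\<^sub>F t in at 0. dist (h' t /\<^sub>R t ^ Suc n) w < e / 2"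
    using lim by (intro tendstoD) auto
  then obtain c where c: "c > 0" "\<And>t. t \<noteq> 0 \<Longrightarrow> \<bar>t\<bar> < c \<Longrightarrow> dist (h' t /\<^sub>R t ^ Suc n) w < e / 2"
    by (auto simp: eventually_at)
  define k where "k t = h t - (t ^ Suc (Suc n) / real (Suc (Suc n))) *\<^sub>R w" for t
  have k': "(k has_vector_derivative (h' t - t ^ Suc n *\<^sub>R w)) (at t)" if "\<bar>t\<bar> < d" for t
    unfolding k_def
    by (rule derivative_eq_intros h[OF that] refl | simp add: field_simps del: of_nat_Suc)+
  have bound: "norm (h' t - t ^ Suc n *\<^sub>R w) \<le> e / 2 * \<bar>t\<bar> ^ Suc n" if "\<bar>t\<bar> < c" for t
  proof (cases "t = 0")
    case False
    then have "h' t - t ^ Suc n *\<^sub>R w = t ^ Suc n *\<^sub>R (h' t /\<^sub>R t ^ Suc n - w)"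
      by (simp add: scaleR_diff_right del: power_Suc)
    then have "norm (h' t - t ^ Suc n *\<^sub>R w) = \<bar>t\<bar> ^ Suc n * dist (h' t /\<^sub>R t ^ Suc n) w"
      by (simp add: dist_norm power_abs abs_mult)
    also have "\<dots> \<le> \<bar>t\<bar> ^ Suc n * (e / 2)"
      using c(2)[OF False that] by (intro mult_left_mono) auto
    finally show ?thesis by (simp add: mult.commute)
  qed (use assms(4) in auto)
  show "\<forall>\<^sub>F t in at 0. dist (h t /\<^sub>R t ^ Suc (Suc n)) (w /\<^sub>R real (Suc (Suc n))) < e"
    unfolding eventually_at
  proof (intro exI[of _ "min c d"] conjI ballI impI)
    show "min c d > 0" using c \<open>d > 0\<close> by simp
    fix t :: real assume t: "t \<noteq> 0 \<and> dist t 0 < min c d"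
    have "norm (k t) \<le> e / 2 * \<bar>t\<bar> ^ Suc (Suc n)"
      by (rule norm_le_power_of_vector_derivative[OF k' bound])
         (use t \<open>e > 0\<close> assms(3) in \<open>auto simp: k_def\<close>)
    moreover have "h t /\<^sub>R t ^ Suc (Suc n) - w /\<^sub>R real (Suc (Suc n)) = k t /\<^sub>R t ^ Suc (Suc n)"
      using t by (simp add: k_def scaleR_diff_right field_simps)
    moreover have "norm (k t /\<^sub>R t ^ Suc (Suc n)) = norm (k t) / \<bar>t\<bar> ^ Suc (Suc n)"
      by (simp add: divide_inverse mult.commute power_abs del: power_Suc)
    moreover have "\<bar>t\<bar> ^ Suc (Suc n) > 0" using t by simp
    ultimately have "dist (h t /\<^sub>R t ^ Suc (Suc n)) (w /\<^sub>R real (Suc (Suc n))) \<le> e / 2"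
      by (simp add: dist_norm pos_divide_le_eq del: power_Suc)
    then show "dist (h t /\<^sub>R t ^ Suc (Suc n)) (w /\<^sub>R real (Suc (Suc n))) < e" using \<open>e > 0\<close> by linarith
  qed
qed

lemma norm_quotient_le:
  fixes X :: "'a::real_normed_vector"
  assumes "norm X \<le> e * \<bar>r\<bar>" "r \<noteq> 0"
  shows "norm (X /\<^sub>R r) \<le> e"
  using assms by (simp add: divide_simps)

text \<open>Limits at a singular point are taken off the singular curve, which contains only singular points,
  so that division by \<open>t\<close> makes sense.\<close>
abbreviation off_axis :: "real \<Rightarrow> (real \<times> real) filter" where
  "off_axis s \<equiv> at (s, 0) within {q. snd q \<noteq> 0}"

lemma tendsto_off_axis:
  fixes h :: "real \<times> real \<Rightarrow> 'b::metric_space"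
  assumes "\<And>e. e > 0 \<Longrightarrow>
    \<exists>d>0. \<forall>a b. \<bar>a - s\<bar> < d \<longrightarrow> \<bar>b\<bar> < d \<longrightarrow> b \<noteq> 0 \<longrightarrow> dist (h (a, b)) l \<le> e"
  shows "(h \<longlongrightarrow> l) (off_axis s)"
proof (rule tendstoI)
  fix e :: real assume "e > 0"
  then obtain d where d: "d > 0" "\<And>a b. \<bar>a - s\<bar> < d \<Longrightarrow> \<bar>b\<bar> < d \<Longrightarrow> b \<noteq> 0 \<Longrightarrow> dist (h (a, b)) l \<le> e / 2"
    using assms[of "e / 2"] by auto
  show "\<forall>\<^sub>F q in off_axis s. dist (h q) l < e"
    unfolding eventually_at
  proof (intro exI[of _ d] conjI ballI impI d)
    fix q :: "real \<times> real" assume q: "q \<in> {q. snd q \<noteq> 0}" "q \<noteq> (s, 0) \<and> dist q (s, 0) < d"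
    then have "\<bar>fst q - s\<bar> < d" "\<bar>snd q\<bar> < d"
      using dist_fst_le[of q "(s, 0)"] dist_snd_le[of q "(s, 0)"] by (auto simp: dist_real_def)
    then show "dist (h q) l < e" using d(2)[of "fst q" "snd q"] q \<open>e > 0\<close> by simp
  qed
qed

context
  fixes S :: "(real \<times> real) set" and h :: "real \<times> real \<Rightarrow> real^3" and s :: real
  assumes S: "open S" and h: "smooth_on S h" and p: "(s, 0) \<in> S"
    and zero: "\<And>u. (u, 0) \<in> S \<Longrightarrow> h (u, 0) = 0"
begin

text \<open>With \<open>h = f_t\<close> this is Hadamard's division by \<open>t\<close>. The limit is taken in both variables,
  as accumulating points may approach \<open>(s, 0)\<close> from any direction.\<close>
lemma quotient_tendsto_dt: "((\<lambda>q. h q /\<^sub>R snd q) \<longlongrightarrow> dt h (s, 0)) (off_axis s)"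
proof (rule tendsto_off_axis)
  fix e :: real assume "e > 0"
  define w where "w = dt h (s, 0)"
  obtain d where d: "d > 0"
    "\<And>a b. \<bar>a - s\<bar> < d \<Longrightarrow> \<bar>b - 0\<bar> < d \<Longrightarrow> (a, b) \<in> S \<and> dist (dt h (a, b)) w < e"
    using isCont_box[OF S p smooth_on_isCont[OF S smooth_on_dt[OF S h] p] \<open>e > 0\<close>] unfolding w_def by metis
  have "dist (h (a, b) /\<^sub>R b) w \<le> e" if ab: "\<bar>a - s\<bar> < d" "\<bar>b\<bar> < d" "b \<noteq> 0" for a b
  proof -
    have "norm (h (a, b) - b *\<^sub>R w) \<le> e * \<bar>b\<bar> ^ Suc 0"
      by (rule norm_le_power_of_vector_derivative[where h'="\<lambda>y. dt h (a, y) - w"])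
         (use ab d zero \<open>e > 0\<close> in \<open>auto simp: dist_norm intro!: derivative_eq_intros has_vector_derivative_dt[OF h] less_imp_le\<close>)
    moreover have "h (a, b) /\<^sub>R b - w = (h (a, b) - b *\<^sub>R w) /\<^sub>R b"
      using ab by (simp add: scaleR_diff_right)
    ultimately show ?thesis
      using ab norm_quotient_le[of "h (a, b) - b *\<^sub>R w" e b] by (simp add: dist_norm del: norm_scaleR)
  qed
  then show "\<exists>d>0. \<forall>a b. \<bar>a - s\<bar> < d \<longrightarrow> \<bar>b\<bar> < d \<longrightarrow> b \<noteq> 0 \<longrightarrow> dist (h (a, b) /\<^sub>R snd (a, b)) (dt h (s, 0)) \<le> e"
    using d(1) w_def by auto
qed

text \<open>For \<open>h = t g\<close> one has \<open>h_t - h / t = t g_t\<close>, so the quotient is \<open>g_t\<close>. This is what survives of \<open>f_tt\<close>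
  in \<open>det (f_s, f_t, f_tt)\<close> after subtracting a multiple of \<open>f_t\<close>.\<close>
lemma second_quotient_tendsto_dt:
  "((\<lambda>q. (dt h q - h q /\<^sub>R snd q) /\<^sub>R snd q) \<longlongrightarrow> dt (dt h) (s, 0) /\<^sub>R 2) (off_axis s)"
proof (rule tendsto_off_axis)
  fix e :: real assume "e > 0"
  define w where "w = dt (dt h) (s, 0)"
  note ht = smooth_on_dt[OF S h]
  obtain d where d: "d > 0"
    "\<And>a b. \<bar>a - s\<bar> < d \<Longrightarrow> \<bar>b - 0\<bar> < d \<Longrightarrow> (a, b) \<in> S \<and> dist (dt (dt h) (a, b)) w < e"
    using isCont_box[OF S p smooth_on_isCont[OF S smooth_on_dt[OF S ht] p] \<open>e > 0\<close>] unfolding w_def by metis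
  have "dist ((dt h (a, b) - h (a, b) /\<^sub>R b) /\<^sub>R b) (w /\<^sub>R 2) \<le> e" if ab: "\<bar>a - s\<bar> < d" "\<bar>b\<bar> < d" "b \<noteq> 0" for a b
  proof -
    have "norm (b *\<^sub>R dt h (a, b) - h (a, b) - (b ^ 2 / 2) *\<^sub>R w) \<le> e * \<bar>b\<bar> ^ Suc 1"
    proof (rule norm_le_power_of_vector_derivative[where h'="\<lambda>y. y *\<^sub>R (dt (dt h) (a, y) - w)"])
      fix y assume "\<bar>y\<bar> \<le> \<bar>b\<bar>"
      then have y: "(a, y) \<in> S" "norm (dt (dt h) (a, y) - w) \<le> e"
        using d(2)[of a y] ab by (auto simp: dist_norm)
      show "((\<lambda>b. b *\<^sub>R dt h (a, b) - h (a, b) - (b ^ 2 / 2) *\<^sub>R w) has_vector_derivative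
          y *\<^sub>R (dt (dt h) (a, y) - w)) (at y)"
        by (rule derivative_eq_intros has_vector_derivative_dt[OF h] has_vector_derivative_dt[OF ht] y refl
           | simp add: scaleR_diff_right)+
      show "norm (y *\<^sub>R (dt (dt h) (a, y) - w)) \<le> e * \<bar>y\<bar> ^ 1"
        using mult_right_mono[OF y(2), of "\<bar>y\<bar>"] by (simp add: mult.commute)
    qed (use ab d zero \<open>e > 0\<close> in auto)
    moreover have "(dt h (a, b) - h (a, b) /\<^sub>R b) /\<^sub>R b - w /\<^sub>R 2
        = (b *\<^sub>R dt h (a, b) - h (a, b) - (b ^ 2 / 2) *\<^sub>R w) /\<^sub>R b ^ 2"
    proof -
      have "inverse b * inverse b * b = inverse b" "inverse b * inverse b * (b * b) = 1"
        using ab by (simp_all add: field_simps)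
      then show ?thesis by (simp add: scaleR_diff_right power2_eq_square)
    qed
    ultimately show ?thesis
      using ab norm_quotient_le[of "b *\<^sub>R dt h (a, b) - h (a, b) - (b ^ 2 / 2) *\<^sub>R w" e "b ^ 2"]
      by (simp add: dist_norm power2_eq_square del: norm_scaleR)
  qed
  then show "\<exists>d>0. \<forall>a b. \<bar>a - s\<bar> < d \<longrightarrow> \<bar>b\<bar> < d \<longrightarrow> b \<noteq> 0 \<longrightarrow>
      dist ((dt h (a, b) - h (a, b) /\<^sub>R snd (a, b)) /\<^sub>R snd (a, b)) (dt (dt h) (s, 0) /\<^sub>R 2) \<le> e"
    using d(1) w_def by auto
qed

end

section \<open>Strict differentiability\<close>

text \<open>A continuously differentiable map is approximated by its derivative at \<open>x0\<close> on differences of any two points near \<open>x0\<close>: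
  the mean value inequality applies to \<open>\<Psi>\<close> minus its derivative at \<open>x0\<close>.\<close>
lemma strict_derivative:
  fixes \<Psi> :: "real^3 \<Rightarrow> real^3"
  assumes A: "open A" and \<Psi>: "smooth_on A \<Psi>" and x0: "x0 \<in> A" and "e > 0"
  shows "\<exists>d>0. \<forall>x\<in>ball x0 d. \<forall>y\<in>ball x0 d.
    norm (\<Psi> x - \<Psi> y - frechet_derivative \<Psi> (at x0) (x - y)) \<le> e * norm (x - y)"
proof -
  define D where "D x = frechet_derivative \<Psi> (at x)" for x
  have der: "(\<Psi> has_derivative D x) (at x)" if "x \<in> A" for x
    using smooth_on_imp_frechet_derivative[OF \<Psi> that] by (simp add: D_def)
  have "isCont (\<lambda>x. D x b) x0" for b
    unfolding D_def by (rule smooth_on_isCont[OF A smooth_on_frechet_derivative[OF \<Psi>] x0])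
  then have "((\<lambda>x. D x b) \<longlongrightarrow> D x0 b) (nhds x0)" for b
    using tendsto_at_iff_tendsto_nhds[of "\<lambda>x. D x b" x0] by (simp add: isCont_def)
  then have "((\<lambda>x. \<Sum>b\<in>Basis. norm (D x b - D x0 b)) \<longlongrightarrow> (\<Sum>b\<in>(Basis :: (real^3) set). norm (D x0 b - D x0 b))) (nhds x0)"
    by (intro tendsto_intros)
  then have "\<forall>\<^sub>F x in nhds x0. (\<Sum>b\<in>Basis. norm (D x b - D x0 b)) < e"
    using \<open>e > 0\<close> by (intro order_tendstoD) auto
  then have "\<forall>\<^sub>F x in nhds x0. x \<in> A \<and> (\<Sum>b\<in>Basis. norm (D x b - D x0 b)) < e"
    using eventually_nhds_in_open[OF A x0] by (intro eventually_conj)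
  then obtain d where d: "d > 0" "\<And>x. x \<in> ball x0 d \<Longrightarrow> x \<in> A \<and> (\<Sum>b\<in>Basis. norm (D x b - D x0 b)) < e"
    unfolding eventually_nhds_metric by (auto simp: dist_commute)
  have "norm (\<Psi> x - \<Psi> y - D x0 (x - y)) \<le> e * norm (x - y)" if "x \<in> ball x0 d" "y \<in> ball x0 d" for x y
  proof -
    have lin: "bounded_linear (D x)" if "x \<in> A" for x using der[OF that] by (rule has_derivative_bounded_linear)
    have "norm ((\<Psi> x - D x0 x) - (\<Psi> y - D x0 y)) \<le> e * norm (x - y)"
    proof (rule differentiable_bound[OF convex_ball _ _ that])
      fix z assume z: "z \<in> ball x0 d"
      then have zA: "z \<in> A" using d(2) by blast
      show "((\<lambda>x. \<Psi> x - D x0 x) has_derivative (\<lambda>h. D z h - D x0 h)) (at z within ball x0 d)"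
        by (rule has_derivative_at_withinI)
          (intro has_derivative_diff der bounded_linear_imp_has_derivative lin x0 zA)
      have "onorm (\<lambda>h. D z h - D x0 h) \<le> (\<Sum>b\<in>Basis. norm (D z b - D x0 b))"
        by (intro onorm_componentwise bounded_linear_sub lin x0 zA)
      then show "onorm (\<lambda>h. D z h - D x0 h) \<le> e" using d(2)[OF z] by linarith
    qed
    then show ?thesis
      unfolding linear_diff[OF bounded_linear.linear[OF lin[OF x0]], of x y] by (simp add: diff_diff_eq2 add.commute add_diff_eq diff_diff_eq)
  qed
  then show ?thesis unfolding D_def using d(1) by blast
qed

text \<open>Both points may move, at a rate unrelated to the size of their difference. This transports the leading term of
  \<open>f (s, t) - f (s, - t)\<close>, which is of third order although both points approach \<open>f (s, 0)\<close> only quadratically,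
  through a diffeomorphism without second derivatives.\<close>
lemma strict_derivative_quotient_tendsto:
  fixes \<Psi> :: "real^3 \<Rightarrow> real^3"
  assumes A: "open A" and \<Psi>: "smooth_on A \<Psi>" and x0: "x0 \<in> A"
    and x: "(x \<longlongrightarrow> x0) F" and y: "(y \<longlongrightarrow> x0) F"
    and q: "((\<lambda>t. (x t - y t) /\<^sub>R r t) \<longlongrightarrow> w) F"
  shows "((\<lambda>t. (\<Psi> (x t) - \<Psi> (y t)) /\<^sub>R r t) \<longlongrightarrow> frechet_derivative \<Psi> (at x0) w) F"
proof -
  define P where "P = frechet_derivative \<Psi> (at x0)"
  have P: "bounded_linear P"
    unfolding P_def using smooth_on_imp_frechet_derivative[OF \<Psi> x0] by (rule has_derivative_bounded_linear)
  have "((\<lambda>t. (\<Psi> (x t) - \<Psi> (y t)) /\<^sub>R r t - P ((x t - y t) /\<^sub>R r t)) \<longlongrightarrow> 0) F"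
  proof (rule tendstoI)
    fix e :: real assume "e > 0"
    define K where "K = norm w + 1"
    have "K > 0" unfolding K_def using norm_ge_zero[of w] by linarith
    then obtain d where d: "d > 0"
      "\<And>x y. x \<in> ball x0 d \<Longrightarrow> y \<in> ball x0 d \<Longrightarrow> norm (\<Psi> x - \<Psi> y - P (x - y)) \<le> e / K * norm (x - y)"
      using strict_derivative[OF A \<Psi> x0, of "e / K"] \<open>e > 0\<close> unfolding P_def by (meson divide_pos_pos)
    have "\<forall>\<^sub>F t in F. norm ((x t - y t) /\<^sub>R r t) < K"
      using tendsto_norm[OF q] unfolding K_def by (intro order_tendstoD) auto
    moreover have "\<forall>\<^sub>F t in F. x t \<in> ball x0 d" "\<forall>\<^sub>F t in F. y t \<in> ball x0 d"
      using tendstoD[OF x d(1)] tendstoD[OF y d(1)] by (simp_all add: dist_commute)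
    ultimately show "\<forall>\<^sub>F t in F. dist ((\<Psi> (x t) - \<Psi> (y t)) /\<^sub>R r t - P ((x t - y t) /\<^sub>R r t)) 0 < e"
    proof eventually_elim
      case (elim t)
      have "norm ((\<Psi> (x t) - \<Psi> (y t)) /\<^sub>R r t - P ((x t - y t) /\<^sub>R r t))
          = norm ((\<Psi> (x t) - \<Psi> (y t) - P (x t - y t)) /\<^sub>R r t)"
        unfolding linear_cmul[OF bounded_linear.linear[OF P]] by (simp only: scaleR_diff_right)
      also have "\<dots> = norm (\<Psi> (x t) - \<Psi> (y t) - P (x t - y t)) * \<bar>inverse (r t)\<bar>" 
        by (simp add: mult.commute)
      also have "\<dots> \<le> (e / K * norm (x t - y t)) * \<bar>inverse (r t)\<bar>"
        by (intro mult_right_mono d(2) elim) auto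
      also have "\<dots> = e / K * norm ((x t - y t) /\<^sub>R r t)" by simp
      also have "\<dots> < e / K * K"
        using elim(1) \<open>e > 0\<close> \<open>K > 0\<close> by (intro mult_strict_left_mono) auto
      finally show ?case using \<open>K > 0\<close> by simp
    qed
  qed
  from tendsto_add[OF this bounded_linear.tendsto[OF P q]] show ?thesis by (simp add: P_def)
qed

section \<open>Determinants and the Lorentzian product\<close>

lemma det3_expand:
  "det3 a b c = a$1 * (b$2 * c$3 - b$3 * c$2) - a$2 * (b$1 * c$3 - b$3 * c$1) + a$3 * (b$1 * c$2 - b$2 * c$1)"
  by (simp add: det3_def det_3 algebra_simps)

lemma det3_scale: "det3 a (r *\<^sub>R b) c = r * det3 a b c" "det3 a b (r *\<^sub>R c) = r * det3 a b c"
  by (simp_all add: det3_expand algebra_simps)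

lemma tendsto_det3 [tendsto_intros]:
  "(a \<longlongrightarrow> a') F \<Longrightarrow> (b \<longlongrightarrow> b') F \<Longrightarrow> (c \<longlongrightarrow> c') F \<Longrightarrow>
    ((\<lambda>x. det3 (a x) (b x) (c x)) \<longlongrightarrow> det3 a' b' c') F"
  unfolding det3_expand by (intro tendsto_intros)

lemma tendsto_inner_L [tendsto_intros]:
  "(a \<longlongrightarrow> a') F \<Longrightarrow> (b \<longlongrightarrow> b') F \<Longrightarrow> ((\<lambda>x. inner_L (a x) (b x)) \<longlongrightarrow> inner_L a' b') F"
  unfolding inner_L_def by (intro tendsto_intros)

lemma det3_linear_image:
  assumes "linear (P :: real^3 \<Rightarrow> real^3)"
  shows "det3 (P a) (P b) (P c) = det (matrix P) * det3 a b c"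
proof -
  define Q where "Q = matrix P"
  have P: "P x = Q *v x" for x
    unfolding Q_def using matrix_vector_mul(2)[OF assms] by metis
  have "(vector [P a, P b, P c] :: real^3^3) = vector [a, b, c] ** transpose Q"
    unfolding P
    by (simp add: vec_eq_iff forall_3 matrix_matrix_mult_def matrix_vector_mult_def transpose_def mult.commute)
  then show ?thesis by (simp add: det3_def det_mul mult.commute Q_def)
qed

lemma inner_L_scale: "inner_L (r *\<^sub>R a) b = r * inner_L a b" "inner_L a (r *\<^sub>R b) = r * inner_L a b"
  by (simp_all add: inner_L_def algebra_simps)

lemma inner_L_cross_L:
  "inner_L (cross_L a b) (cross_L a b) = (inner_L a b)\<^sup>2 - inner_L a a * inner_L b b"
  by (simp add: inner_L_def cross_L_def cross3_def E3_def matrix_vector_mult_def sum_3 power2_eq_square algebra_simps)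

lemma has_vector_derivative_vector_3:
  assumes "(x has_vector_derivative x') F" "(y has_vector_derivative y') F" "(z has_vector_derivative z') F"
  shows "((\<lambda>t. vector [x t, y t, z t] :: real^3) has_vector_derivative vector [x', y', z']) F"
proof -
  have "((\<lambda>t. a t *\<^sub>R (axis i 1 :: real^3)) has_vector_derivative a' *\<^sub>R axis i 1) F"
    if "(a has_vector_derivative a') F" for a a' i
    using bounded_linear.has_vector_derivative[OF bounded_linear_scaleR_left that] .
  then show ?thesis
    unfolding vector_3_eq_axis using assms by (intro has_vector_derivative_add)
qed

section \<open>Cuspidal edge singular points are non-degenerate\<close>

lemma even_difference_tendsto:
  fixes f :: "real \<times> real \<Rightarrow> real^3"
  assumes "open S" and f: "smooth_on S f" and "(s, 0) \<in> S" and "dt f (s, 0) = 0"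
  shows "((\<lambda>t. (f (s, t) - f (s, 0)) /\<^sub>R t ^ 2) \<longlongrightarrow> dt (dt f) (s, 0) /\<^sub>R 2) (at 0)"
proof -
  obtain d where d: "d > 0" "\<And>b. \<bar>b\<bar> < d \<Longrightarrow> (s, b) \<in> S"
    using box_in_open[OF assms(1,3)] by (metis abs_zero diff_0_right diff_self)
  have "((\<lambda>t. (f (s, t) - f (s, 0)) /\<^sub>R t ^ Suc (Suc 0)) \<longlongrightarrow> dt (dt f) (s, 0) /\<^sub>R real (Suc (Suc 0))) (at 0)"
  proof (rule lhopital_power_vector[OF d(1), where h'="\<lambda>t. dt f (s, t)"])
    show "((\<lambda>t. f (s, t) - f (s, 0)) has_vector_derivative dt f (s, t)) (at t)" if "\<bar>t\<bar> < d" for t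
      using has_vector_derivative_dt[OF f d(2)[OF that]] by (simp add: has_vector_derivative_diff_const)
    show "((\<lambda>t. dt f (s, t) /\<^sub>R t ^ Suc 0) \<longlongrightarrow> dt (dt f) (s, 0)) (at 0)"
      using has_vector_derivative_quotient_tendsto[OF has_vector_derivative_dt[OF smooth_on_dt[OF assms(1) f] assms(3)]]
        assms(4) by simp
  qed (use assms in auto)
  then show ?thesis by (simp add: power2_eq_square)
qed

text \<open>The odd part of \<open>t \<mapsto> f (s, t)\<close> isolates the third derivative from the quadratic term.\<close>
lemma odd_difference_tendsto:
  fixes f :: "real \<times> real \<Rightarrow> real^3"
  assumes "open S" and f: "smooth_on S f" and "(s, 0) \<in> S" and "dt f (s, 0) = 0"
  shows "((\<lambda>t. (f (s, t) - f (s, - t)) /\<^sub>R t ^ 3) \<longlongrightarrow> dt (dt (dt f)) (s, 0) /\<^sub>R 3) (at 0)"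
proof -
  obtain d where d: "d > 0" "\<And>b. \<bar>b\<bar> < d \<Longrightarrow> (s, b) \<in> S"
    using box_in_open[OF assms(1,3)] by (metis abs_zero diff_0_right diff_self)
  note ft = smooth_on_dt[OF assms(1) f]
  note ftt = smooth_on_dt[OF assms(1) ft]
  have reflected: "((\<lambda>t. h (s, - t)) has_vector_derivative - dt h (s, - t)) (at t)"
    if "\<bar>t\<bar> < d" "smooth_on S h" for t and h :: "real \<times> real \<Rightarrow> real^3"
    using vector_diff_chain_at[of uminus "-1" t "\<lambda>t. h (s, t)" "dt h (s, - t)"]
      has_vector_derivative_dt[OF that(2) d(2), of "- t"] that(1)
      has_vector_derivative_minus[OF has_vector_derivative_id, of "at t"]
    by (simp add: o_def)
  define w where "w = dt (dt (dt f)) (s, 0)"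
  have "((\<lambda>t. dt (dt f) (s, t) - dt (dt f) (s, - t)) has_vector_derivative w - - w) (at 0)"
    using reflected[OF _ ftt, of 0] d unfolding w_def
    by (intro has_vector_derivative_diff has_vector_derivative_dt[OF ftt]) auto
  from has_vector_derivative_quotient_tendsto[OF this]
  have 1: "((\<lambda>t. (dt (dt f) (s, t) - dt (dt f) (s, - t)) /\<^sub>R t ^ Suc 0) \<longlongrightarrow> 2 *\<^sub>R w) (at 0)"
    by (simp add: scaleR_2)
  have 2: "((\<lambda>t. (dt f (s, t) + dt f (s, - t)) /\<^sub>R t ^ Suc (Suc 0)) \<longlongrightarrow> (2 *\<^sub>R w) /\<^sub>R real (Suc (Suc 0))) (at 0)"
  proof (rule lhopital_power_vector[OF d(1) _ _ _ 1])
    show "((\<lambda>t. dt f (s, t) + dt f (s, - t)) has_vector_derivative dt (dt f) (s, t) - dt (dt f) (s, - t)) (at t)"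
      if "\<bar>t\<bar> < d" for t
      using has_vector_derivative_add[OF has_vector_derivative_dt[OF ft d(2)[OF that]] reflected[OF that ft]] by simp
  qed (use assms in auto)
  have "((\<lambda>t. (f (s, t) - f (s, - t)) /\<^sub>R t ^ Suc (Suc (Suc 0)))
      \<longlongrightarrow> ((2 *\<^sub>R w) /\<^sub>R real (Suc (Suc 0))) /\<^sub>R real (Suc (Suc (Suc 0)))) (at 0)"
  proof (rule lhopital_power_vector[OF d(1) _ _ _ 2])
    show "((\<lambda>t. f (s, t) - f (s, - t)) has_vector_derivative dt f (s, t) + dt f (s, - t)) (at t)"
      if "\<bar>t\<bar> < d" for t
      using has_vector_derivative_diff[OF has_vector_derivative_dt[OF f d(2)[OF that]] reflected[OF that f]] by simp
  qed (use assms in auto)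
  then show ?thesis by (simp add: w_def numeral_3_eq_3 del: power_Suc)
qed

text \<open>Let \<open>\<Psi> \<circ> f = (u, v\<^sup>2, v\<^sup>3)\<close> with a local diffeomorphism \<open>\<phi> = (u, v)\<close>, and let \<open>P\<close> be the derivative of \<open>\<Psi>\<close>.
  The first derivatives give \<open>P f_s = (u_s, 0, 0)\<close> and \<open>0 = P f_t = (u_t, 0, 0)\<close>, hence \<open>u_s \<noteq> 0\<close> and \<open>v_t \<noteq> 0\<close>;
  the even and odd differences in \<open>t\<close> give \<open>P f_tt = (_, 2 v_t\<^sup>2, 0)\<close> and \<open>P f_ttt = (_, _, 6 v_t\<^sup>3)\<close>.
  These three images are the rows of a triangular matrix with non-zero diagonal.\<close>
lemma cuspidal_edge_singular_point_nondegenerate: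
  fixes f :: "real \<times> real \<Rightarrow> real^3"
  assumes S: "open (strip I \<delta>)" and f: "smooth_on (strip I \<delta>) f" and p: "(s, 0) \<in> strip I \<delta>"
    and sing: "dt f (s, 0) = 0"
    and cusp: "cuspidal_edge_singular_point I \<delta> f (s, 0)"
  shows "det3 (ds f (s, 0)) (dt (dt f) (s, 0)) (dt (dt (dt f)) (s, 0)) \<noteq> 0"
proof -
  obtain U V \<phi> A B \<Psi> where U: "(s, 0) \<in> U" "U \<subseteq> strip I \<delta>" and \<phi>: "diffeo_on U V \<phi>" "\<phi> (s, 0) = (0, 0)"
    and A: "f ` U \<subseteq> A" and \<Psi>: "diffeo_on A B \<Psi>" "\<Psi> (f (s, 0)) = 0"
    and eq: "\<And>q. q \<in> U \<Longrightarrow> \<Psi> (f q) = standard_cusp (\<phi> q)"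
    using cusp unfolding cuspidal_edge_singular_point_def by blast
  have oU: "open U" and s\<phi>: "smooth_on U \<phi>" and oA: "open A" and s\<Psi>: "smooth_on A \<Psi>"
    using \<phi> \<Psi> by (auto simp: diffeo_on_def)
  obtain \<psi> where s\<psi>: "smooth_on V \<psi>" and hom: "homeomorphism U V \<phi> \<psi>"
    using \<phi> by (auto simp: diffeo_on_def)
  have fA: "f (s, 0) \<in> A" using A U by auto
  define P where "P = frechet_derivative \<Psi> (at (f (s, 0)))"
  define Q where "Q = frechet_derivative \<phi> (at (s, 0))"
  have dP: "(\<Psi> has_derivative P) (at (f (s, 0)))"
    unfolding P_def by (rule smooth_on_imp_frechet_derivative[OF s\<Psi> fA])
  have dQ: "(\<phi> has_derivative Q) (at (s, 0))"
    unfolding Q_def by (rule smooth_on_imp_frechet_derivative[OF s\<phi> U(1)])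
  have linP: "linear P" and linQ: "linear Q"
    using dP dQ has_derivative_linear by auto
  have Qinj: "h = 0" if "Q h = 0" for h
  proof -
    define R where "R = frechet_derivative \<psi> (at (\<phi> (s, 0)))"
    have "\<phi> (s, 0) \<in> V" using hom U by (auto simp: homeomorphism_def)
    then have dR: "(\<psi> has_derivative R) (at (\<phi> (s, 0)))"
      unfolding R_def by (rule smooth_on_imp_frechet_derivative[OF s\<psi>])
    have "((\<lambda>q. \<psi> (\<phi> q)) has_derivative (\<lambda>h. R (Q h))) (at (s, 0))"
      using diff_chain_at[OF dQ dR] by (simp add: o_def)
    then have "((\<lambda>q. q) has_derivative (\<lambda>h. R (Q h))) (at (s, 0))"
      by (rule has_derivative_transform_within_open[OF _ oU U(1)]) (use hom in \<open>auto simp: homeomorphism_def\<close>)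
    then have "(\<lambda>h. R (Q h)) = (\<lambda>h. h)" by (intro has_derivative_unique) auto
    then have "h = R (Q h)" by metis
    then show ?thesis using that linear_0[OF has_derivative_linear[OF dR]] by simp
  qed
  (* Along any curve c through (s, 0) only the first component of (u, v^2, v^3) has a derivative there, as v vanishes. *)
  have chain: "P g' = vector [fst b, 0, 0]"
    if "(c has_vector_derivative c') (at x)" "((\<lambda>y. f (c y)) has_vector_derivative g') (at x)"
      "((\<lambda>y. \<phi> (c y)) has_vector_derivative b) (at x)" "c x = (s, 0)" for c c' x g' b
  proof -
    have "isCont c x" using that(1) by (rule has_vector_derivative_continuous)
    then have ev: "\<forall>\<^sub>F y in nhds x. c y \<in> U"
      using tendsto_at_iff_tendsto_nhds[of c x] oU U(1) that(4) by (auto simp: isCont_def dest: topological_tendstoD)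
    have 1: "((\<lambda>y. \<Psi> (f (c y))) has_vector_derivative P g') (at x)"
      using vector_derivative_diff_chain_within[OF that(2), of \<Psi> P] dP that(4)
      by (auto simp: o_def intro: has_derivative_at_withinI)
    have u: "((\<lambda>y. fst (\<phi> (c y))) has_vector_derivative fst b) (at x)"
      and v: "((\<lambda>y. snd (\<phi> (c y))) has_vector_derivative snd b) (at x)"
      using bounded_linear.has_vector_derivative[OF bounded_linear_fst that(3)]
        bounded_linear.has_vector_derivative[OF bounded_linear_snd that(3)] by auto
    have "((\<lambda>y. standard_cusp (\<phi> (c y))) has_vector_derivative vector [fst b, 0, 0]) (at x)"
      unfolding standard_cusp_def case_prod_beta
    proof (rule has_vector_derivative_vector_3[OF u])
      note v' = v[folded has_real_derivative_iff_has_vector_derivative]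
      show "((\<lambda>y. (snd (\<phi> (c y)))\<^sup>2) has_vector_derivative 0) (at x)"
        unfolding has_real_derivative_iff_has_vector_derivative[symmetric]
        by (rule derivative_eq_intros v' refl)+ (simp add: that(4) \<phi>)
      show "((\<lambda>y. (snd (\<phi> (c y))) ^ 3) has_vector_derivative 0) (at x)"
        unfolding has_real_derivative_iff_has_vector_derivative[symmetric]
        by (rule derivative_eq_intros v' refl)+ (simp add: that(4) \<phi>)
    qed
    moreover obtain T where "open T" "x \<in> T" "\<And>y. y \<in> T \<Longrightarrow> c y \<in> U"
      using ev unfolding eventually_nhds by blast
    then have "((\<lambda>y. standard_cusp (\<phi> (c y))) has_vector_derivative P g') (at x)"
      using has_vector_derivative_transform_within_open[OF 1, of T "\<lambda>y. standard_cusp (\<phi> (c y))"] eq by simp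
    ultimately show ?thesis using vector_derivative_unique_at by blast
  qed
  have Ps: "P (ds f (s, 0)) = vector [fst (Q (1, 0)), 0, 0]"
    by (rule chain[where c="\<lambda>x. (x, 0)" and c'="(1, 0)"])
       (use has_vector_derivative_ds[OF f p] has_vector_derivative_along_s[OF s\<phi> U(1)] in
        \<open>auto simp: Q_def intro!: has_vector_derivative_Pair derivative_eq_intros\<close>)
  have Pt: "P (dt f (s, 0)) = vector [fst (Q (0, 1)), 0, 0]"
    by (rule chain[where c="\<lambda>x. (s, x)" and c'="(0, 1)"])
       (use has_vector_derivative_dt[OF f p] has_vector_derivative_along_t[OF s\<phi> U(1)] in
        \<open>auto simp: Q_def intro!: has_vector_derivative_Pair derivative_eq_intros\<close>)
  define \<alpha> where "\<alpha> = fst (Q (1, 0))"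
  define \<beta> where "\<beta> = snd (Q (0, 1))"
  have Qt: "Q (0, 1) = (0, \<beta>)"
    using Pt linear_0[OF linP] by (simp add: sing \<beta>_def prod_eq_iff vec_eq_iff forall_3)
  have "\<beta> \<noteq> 0"
    using Qinj[of "(0, 1)"] Qt by (auto simp: zero_prod_def)
  have "\<alpha> \<noteq> 0"
  proof
    assume "\<alpha> = 0"
    then obtain \<gamma> where \<gamma>: "Q (1, 0) = (0, \<gamma>)" by (metis \<alpha>_def prod.collapse)
    have "Q (\<beta> *\<^sub>R (1, 0) - \<gamma> *\<^sub>R (0, 1)) = 0"
      unfolding linear_diff[OF linQ] linear_cmul[OF linQ] Qt \<gamma> by (simp add: zero_prod_def)
    from Qinj[OF this] \<open>\<beta> \<noteq> 0\<close> show False by (simp add: zero_prod_def)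
  qed
  (* The strict derivative turns the leading terms of the even and odd differences of f into those of (u, v^2, v^3). *)
  define v where "v t = snd (\<phi> (s, t))" for t
  have v0: "v 0 = 0" by (simp add: v_def \<phi>)
  have dv: "(v has_vector_derivative \<beta>) (at 0)"
    using bounded_linear.has_vector_derivative[OF bounded_linear_snd has_vector_derivative_along_t[OF s\<phi> U(1)]]
    by (simp add: v_def[abs_def] \<beta>_def Q_def)
  have v1: "((\<lambda>t. v t / t) \<longlongrightarrow> \<beta>) (at 0)"
    using has_vector_derivative_quotient_tendsto[OF dv] by (simp add: v0 divide_inverse mult.commute)
  have um: "filterlim uminus (at 0) (at (0 :: real))"
    using tendsto_minus[OF tendsto_ident_at, of "0::real" UNIV] by (simp add: filterlim_at eventually_at_filter)
  have v2: "((\<lambda>t. v (- t) / t) \<longlongrightarrow> - \<beta>) (at 0)"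
    using tendsto_minus[OF filterlim_compose[OF v1 um]] by simp
  obtain d where d: "d > 0" "\<And>b. \<bar>b\<bar> < d \<Longrightarrow> (s, b) \<in> U"
    using box_in_open[OF oU U(1)] by (metis abs_zero diff_0_right diff_self)
  have ev: "\<forall>\<^sub>F t in at 0. (s, t) \<in> U \<and> (s, - t) \<in> U \<and> t \<noteq> 0"
    unfolding eventually_at using d by (intro exI[of _ d]) auto
  have F: "((\<lambda>t. f (s, t)) \<longlongrightarrow> f (s, 0)) (at 0)"
    using has_vector_derivative_continuous[OF has_vector_derivative_dt[OF f p]] by (simp add: isCont_def)
  have F': "((\<lambda>t. f (s, - t)) \<longlongrightarrow> f (s, 0)) (at 0)"
    using filterlim_compose[OF F um] .
  define a where "a = dt (dt f) (s, 0) /\<^sub>R 2"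
  define b where "b = dt (dt (dt f)) (s, 0) /\<^sub>R 3"
  have lima: "((\<lambda>t. (\<Psi> (f (s, t)) - \<Psi> (f (s, 0))) /\<^sub>R t ^ 2) \<longlongrightarrow> P a) (at 0)"
    unfolding P_def a_def
    by (rule strict_derivative_quotient_tendsto[OF oA s\<Psi> fA F tendsto_const even_difference_tendsto[OF S f p sing]])
  have limb: "((\<lambda>t. (\<Psi> (f (s, t)) - \<Psi> (f (s, - t))) /\<^sub>R t ^ 3) \<longlongrightarrow> P b) (at 0)"
    unfolding P_def b_def
    by (rule strict_derivative_quotient_tendsto[OF oA s\<Psi> fA F F' odd_difference_tendsto[OF S f p sing]])
  have "P a $ 2 = \<beta>\<^sup>2"
  proof (rule tendsto_unique[OF _ tendsto_vec_nth[OF lima]])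
    show "((\<lambda>t. ((\<Psi> (f (s, t)) - \<Psi> (f (s, 0))) /\<^sub>R t ^ 2) $ 2) \<longlongrightarrow> \<beta>\<^sup>2) (at 0)"
    proof (rule Lim_transform_eventually[OF tendsto_power[OF v1, of 2]])
      show "\<forall>\<^sub>F t in at 0. (v t / t)\<^sup>2 = ((\<Psi> (f (s, t)) - \<Psi> (f (s, 0))) /\<^sub>R t ^ 2) $ 2"
        using ev by eventually_elim (simp add: eq U \<Psi> standard_cusp_def case_prod_beta v_def field_simps)
    qed
  qed simp
  moreover have "P a $ 3 = 0"
  proof (rule tendsto_unique[OF _ tendsto_vec_nth[OF lima]])
    have "((\<lambda>t. (v t / t) ^ 3 * t) \<longlongrightarrow> \<beta> ^ 3 * 0) (at 0)"
      by (intro tendsto_intros v1)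
    then have "((\<lambda>t. (v t / t) ^ 3 * t) \<longlongrightarrow> 0) (at 0)" by simp
    then show "((\<lambda>t. ((\<Psi> (f (s, t)) - \<Psi> (f (s, 0))) /\<^sub>R t ^ 2) $ 3) \<longlongrightarrow> 0) (at 0)"
    proof (rule Lim_transform_eventually)
      show "\<forall>\<^sub>F t in at 0. (v t / t) ^ 3 * t = ((\<Psi> (f (s, t)) - \<Psi> (f (s, 0))) /\<^sub>R t ^ 2) $ 3"
        using ev by eventually_elim
          (simp add: eq U \<Psi> standard_cusp_def case_prod_beta v_def field_simps power2_eq_square power3_eq_cube)
    qed
  qed simp
  moreover have "P b $ 3 = 2 * \<beta> ^ 3"
  proof (rule tendsto_unique[OF _ tendsto_vec_nth[OF limb]])
    have "((\<lambda>t. (v t / t) ^ 3 - (v (- t) / t) ^ 3) \<longlongrightarrow> \<beta> ^ 3 - (- \<beta>) ^ 3) (at 0)"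
      by (intro tendsto_intros v1 v2)
    then have "((\<lambda>t. (v t / t) ^ 3 - (v (- t) / t) ^ 3) \<longlongrightarrow> 2 * \<beta> ^ 3) (at 0)" by simp
    then show "((\<lambda>t. ((\<Psi> (f (s, t)) - \<Psi> (f (s, - t))) /\<^sub>R t ^ 3) $ 3) \<longlongrightarrow> 2 * \<beta> ^ 3) (at 0)"
    proof (rule Lim_transform_eventually)
      show "\<forall>\<^sub>F t in at 0. (v t / t) ^ 3 - (v (- t) / t) ^ 3 = ((\<Psi> (f (s, t)) - \<Psi> (f (s, - t))) /\<^sub>R t ^ 3) $ 3"
        using ev by eventually_elim
          (simp add: eq standard_cusp_def case_prod_beta v_def power_mult_distrib power_inverse divide_inverse algebra_simps)
    qed
  qed simp
  ultimately have "det3 (P (ds f (s, 0))) (P a) (P b) = \<alpha> * (\<beta>\<^sup>2 * (2 * \<beta> ^ 3))"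
    unfolding Ps by (simp add: det3_expand \<alpha>_def)
  then have "det3 (ds f (s, 0)) a b \<noteq> 0"
    using det3_linear_image[OF linP, of "ds f (s, 0)" a b] \<open>\<alpha> \<noteq> 0\<close> \<open>\<beta> \<noteq> 0\<close> by auto
  then show ?thesis by (simp add: a_def b_def det3_scale)
qed

section \<open>Coinciding principal curvatures\<close>

text \<open>Written with the characteristic polynomial as a product, so that coinciding roots can be read off.\<close>
lemma eigenvalue_2_iff:
  fixes A :: "'a::field^2^2"
  shows "(\<exists>v. v \<noteq> 0 \<and> A *v v = k *s v) \<longleftrightarrow> (k - A$1$1) * (k - A$2$2) = A$1$2 * A$2$1"
proof
  assume "\<exists>v. v \<noteq> 0 \<and> A *v v = k *s v"
  then obtain v :: "'a^2" where "v \<noteq> 0" and e: "A$1$1 * v$1 + A$1$2 * v$2 = k * v$1" "A$2$1 * v$1 + A$2$2 * v$2 = k * v$2"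
    by (auto simp: vec_eq_iff forall_2 matrix_vector_mult_def sum_2)
  define D where "D = (k - A$1$1) * (k - A$2$2) - A$1$2 * A$2$1"
  have "D * v$1 = 0" "D * v$2 = 0"
    using e unfolding D_def by algebra+
  then show "(k - A$1$1) * (k - A$2$2) = A$1$2 * A$2$1"
    using \<open>v \<noteq> 0\<close> by (auto simp: D_def vec_eq_iff forall_2)
next
  assume D: "(k - A$1$1) * (k - A$2$2) = A$1$2 * A$2$1"
  have eig: "A *v v = k *s v"
    if "A$1$1 * v$1 + A$1$2 * v$2 = k * v$1" "A$2$1 * v$1 + A$2$2 * v$2 = k * v$2" for v :: "'a^2"
    using that by (simp add: vec_eq_iff forall_2 matrix_vector_mult_def sum_2)
  consider "A$1$2 \<noteq> 0 \<or> k \<noteq> A$1$1" | "A$2$1 \<noteq> 0 \<or> k \<noteq> A$2$2"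
    | "A$1$2 = 0" "A$2$1 = 0" "k = A$1$1" "k = A$2$2" by blast
  then show "\<exists>v. v \<noteq> 0 \<and> A *v v = k *s v"
  proof cases
    case 1
    have "A *v vector [A$1$2, k - A$1$1] = k *s vector [A$1$2, k - A$1$1]"
      by (rule eig) (use D in \<open>auto simp: algebra_simps\<close>)
    then show ?thesis using 1
      by (intro exI[of _ "vector [A$1$2, k - A$1$1]"]) (auto simp: vec_eq_iff forall_2)
  next
    case 2
    have "A *v vector [k - A$2$2, A$2$1] = k *s vector [k - A$2$2, A$2$1]"
      by (rule eig) (use D in \<open>auto simp: algebra_simps\<close>)
    then show ?thesis using 2
      by (intro exI[of _ "vector [k - A$2$2, A$2$1]"]) (auto simp: vec_eq_iff forall_2)
  next
    case 3
    then show ?thesis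
      by (intro exI[of _ "vector [1, 0]"] conjI eig) (auto simp: vec_eq_iff forall_2)
  qed
qed

lemma is_singleton_quadratic_roots:
  fixes a b c d :: complex
  shows "is_singleton {k. (k - a) * (k - d) = b * c} \<longleftrightarrow> (a - d)\<^sup>2 + 4 * (b * c) = 0"
proof
  assume "is_singleton {k. (k - a) * (k - d) = b * c}"
  then obtain k where k: "{k. (k - a) * (k - d) = b * c} = {k}" by (auto simp: is_singleton_def)
  then have r: "(k - a) * (k - d) = b * c" by auto
  then have "a + d - k \<in> {k. (k - a) * (k - d) = b * c}" by (simp add: algebra_simps)
  then have "a + d - k = k" using k by auto
  with r show "(a - d)\<^sup>2 + 4 * (b * c) = 0" by algebra
next
  assume z: "(a - d)\<^sup>2 + 4 * (b * c) = 0"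
  have "{k. (k - a) * (k - d) = b * c} = {(a + d) / 2}"
  proof (intro set_eqI)
    fix k
    have "4 * ((k - a) * (k - d) - b * c) = (2 * k - (a + d))\<^sup>2 - ((a - d)\<^sup>2 + 4 * (b * c))"
      by (simp add: power2_eq_square algebra_simps)
    then have "(k - a) * (k - d) = b * c \<longleftrightarrow> 2 * k - (a + d) = 0" using z by auto
    also have "\<dots> \<longleftrightarrow> k = (a + d) / 2" by (auto simp: field_simps)
    finally show "k \<in> {k. (k - a) * (k - d) = b * c} \<longleftrightarrow> k \<in> {(a + d) / 2}" by simp
  qed
  then show "is_singleton {k. (k - a) * (k - d) = b * c}" by simp
qed

lemma W_L_entries:
  fixes f p
  defines "c \<equiv> 1 / (Delta_L f p * sqrt \<bar>Delta_L f p\<bar>)"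
  shows "W_L f p $ 1 $ 1 = c * (G_L f p * L_tilde f p - F_L f p * M_tilde f p)"
    "W_L f p $ 1 $ 2 = c * (G_L f p * M_tilde f p - F_L f p * N_tilde f p)"
    "W_L f p $ 2 $ 1 = c * (E_L f p * M_tilde f p - F_L f p * L_tilde f p)"
    "W_L f p $ 2 $ 2 = c * (E_L f p * N_tilde f p - F_L f p * M_tilde f p)"
  by (simp_all add: W_L_def c_def matrix_matrix_mult_def sum_2)

lemma is_singleton_principal_curvatures_iff:
  assumes "Delta_L f p \<noteq> 0"
  shows "is_singleton (principal_curvatures f p) \<longleftrightarrow>
    (G_L f p * L_tilde f p - E_L f p * N_tilde f p)\<^sup>2 +
      4 * ((G_L f p * M_tilde f p - F_L f p * N_tilde f p) * (E_L f p * M_tilde f p - F_L f p * L_tilde f p)) = 0"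
    (is "_ \<longleftrightarrow> ?D = 0")
proof -
  define c where "c = 1 / (Delta_L f p * sqrt \<bar>Delta_L f p\<bar>)"
  define w where "w i j = complex_of_real (W_L f p $ i $ j)" for i j
  have "is_singleton (principal_curvatures f p) \<longleftrightarrow> (w 1 1 - w 2 2)\<^sup>2 + 4 * (w 1 2 * w 2 1) = 0"
    unfolding principal_curvatures_def eigenvalue_2_iff w_def
    by (simp add: is_singleton_quadratic_roots)
  also have "\<dots> \<longleftrightarrow> complex_of_real ((W_L f p $ 1 $ 1 - W_L f p $ 2 $ 2)\<^sup>2 + 4 * (W_L f p $ 1 $ 2 * W_L f p $ 2 $ 1)) = complex_of_real 0"
    by (simp add: w_def)
  also have "\<dots> \<longleftrightarrow> (W_L f p $ 1 $ 1 - W_L f p $ 2 $ 2)\<^sup>2 + 4 * (W_L f p $ 1 $ 2 * W_L f p $ 2 $ 1) = 0"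
    by (simp only: of_real_eq_iff)
  also have "(W_L f p $ 1 $ 1 - W_L f p $ 2 $ 2)\<^sup>2 + 4 * (W_L f p $ 1 $ 2 * W_L f p $ 2 $ 1) = c\<^sup>2 * ?D"
    unfolding W_L_entries c_def[symmetric] by (simp add: power2_eq_square algebra_simps)
  also have "\<dots> = 0 \<longleftrightarrow> ?D = 0" using assms by (simp add: c_def)
  finally show ?thesis .
qed

text \<open>By the Lagrange identity for \<open>\<times>\<^sub>L\<close>, causal characters off the singular curve are given by the sign of \<open>\<Delta>\<^sub>L\<close>.\<close>
lemma inner_L_nu_L:
  assumes "snd p \<noteq> 0"
  shows "inner_L (nu_L f p) (nu_L f p) = - Delta_L f p / (snd p)\<^sup>2"
  using assms
  by (cases p) (simp add: nu_L_def inner_L_cross_L inner_L_scale Delta_L_def E_L_def F_L_def G_L_def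
      power2_eq_square field_simps)

section \<open>The order of a singular point\<close>

lemma higher_deriv_eqI:
  fixes Q :: "nat \<Rightarrow> real \<Rightarrow> real"
  assumes "open T" and Q: "\<And>k t. k < n \<Longrightarrow> t \<in> T \<Longrightarrow> (Q k has_real_derivative Q (Suc k) t) (at t)"
  shows "k \<le> n \<Longrightarrow> t \<in> T \<Longrightarrow> (deriv ^^ k) (Q 0) t = Q k t"
proof (induction k arbitrary: t)
  case (Suc k)
  have "\<forall>\<^sub>F x in nhds t. (deriv ^^ k) (Q 0) x = Q k x"
    using eventually_nhds_in_open[OF assms(1) Suc.prems(2)] Suc by (auto elim: eventually_mono)
  then have "deriv ((deriv ^^ k) (Q 0)) t = deriv (Q k) t" by (intro deriv_cong_ev) auto
  also have "\<dots> = Q (Suc k) t" using Suc.prems Q by (intro DERIV_imp_deriv) auto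
  finally show ?case by simp
qed simp

text \<open>The product of two functions that vanish to second order vanishes to fourth order: in the Leibniz formula for
  a derivative of order at most 3, one factor of each term is differentiated at most once.\<close>
lemma deriv_quadratic_expression_vanishes:
  fixes e f g :: "real \<Rightarrow> real"
  assumes "d > 0"
    and e: "\<And>t. \<bar>t\<bar> < d \<Longrightarrow> DERIV e t :> e1 t \<and> DERIV e1 t :> e2 t \<and> DERIV e2 t :> e3 t"
    and f: "\<And>t. \<bar>t\<bar> < d \<Longrightarrow> DERIV f t :> f1 t \<and> DERIV f1 t :> f2 t \<and> DERIV f2 t :> f3 t"
    and g: "\<And>t. \<bar>t\<bar> < d \<Longrightarrow> DERIV g t :> g1 t \<and> DERIV g1 t :> g2 t \<and> DERIV g2 t :> g3 t"
    and zero: "e 0 = 0" "e1 0 = 0" "f 0 = 0" "f1 0 = 0" "g 0 = 0" "g1 0 = 0"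
    and "k < 4"
  shows "(deriv ^^ k) (\<lambda>t. e t * g t - (f t)\<^sup>2) 0 = 0"
proof -
  define Q where "Q = (!) [\<lambda>t. e t * g t - (f t)\<^sup>2,
    \<lambda>t. e1 t * g t + e t * g1 t - 2 * (f t * f1 t),
    \<lambda>t. e2 t * g t + 2 * (e1 t * g1 t) + e t * g2 t - 2 * (f1 t * f1 t + f t * f2 t),
    \<lambda>t. e3 t * g t + 3 * (e2 t * g1 t + e1 t * g2 t) + e t * g3 t - 2 * (3 * (f1 t * f2 t) + f t * f3 t)]"
  have "(Q j has_real_derivative Q (Suc j) t) (at t)" if "j < 3" "t \<in> {-d<..<d}" for j t
  proof -
    have t: "\<bar>t\<bar> < d" using that by auto
    note der = e[OF t, THEN conjunct1] e[OF t, THEN conjunct2, THEN conjunct1] e[OF t, THEN conjunct2, THEN conjunct2]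
      f[OF t, THEN conjunct1] f[OF t, THEN conjunct2, THEN conjunct1] f[OF t, THEN conjunct2, THEN conjunct2]
      g[OF t, THEN conjunct1] g[OF t, THEN conjunct2, THEN conjunct1] g[OF t, THEN conjunct2, THEN conjunct2]
    consider "j = 0" | "j = 1" | "j = 2" using \<open>j < 3\<close> by linarith
    then show ?thesis
      by cases (simp_all add: Q_def, (rule derivative_eq_intros der refl | simp add: algebra_simps power2_eq_square)+)
  qed
  then have "(deriv ^^ k) (Q 0) 0 = Q k 0"
    using \<open>d > 0\<close> \<open>k < 4\<close> by (intro higher_deriv_eqI[of "{-d<..<d}" 3]) auto
  moreover have "k = 0 \<or> k = 1 \<or> k = 2 \<or> k = 3" using \<open>k < 4\<close> by linarith
  ultimately show ?thesis by (auto simp: Q_def zero)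
qed

lemma DERIV_inner_L:
  assumes "(x has_vector_derivative x') (at t)" "(y has_vector_derivative y') (at t)"
  shows "DERIV (\<lambda>t. inner_L (x t) (y t)) t :> inner_L x' (y t) + inner_L (x t) y'"
proof -
  have "((\<lambda>t. u t $ i) has_real_derivative u' $ i) (at t)" if "(u has_vector_derivative u') (at t)" for u :: "real \<Rightarrow> real^3" and u' i
    using bounded_linear.has_vector_derivative[OF bounded_linear_vec_nth that] has_real_derivative_iff_has_vector_derivative by blast
  note [derivative_intros] = this[OF assms(1)] this[OF assms(2)]
  show ?thesis unfolding inner_L_def by (auto intro!: derivative_eq_intros)
qed

text \<open>At a double zero the Leibniz formula involves the values of the first derivative and the mere existence of the next two.\<close>
lemma inner_L_three_derivatives:
  assumes x: "\<And>t. \<bar>t\<bar> < d \<Longrightarrow> (x has_vector_derivative x1 t) (at t)"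
      "\<And>t. \<bar>t\<bar> < d \<Longrightarrow> (x1 has_vector_derivative x2 t) (at t)"
      "\<And>t. \<bar>t\<bar> < d \<Longrightarrow> (x2 has_vector_derivative x3 t) (at t)"
    and y: "\<And>t. \<bar>t\<bar> < d \<Longrightarrow> (y has_vector_derivative y1 t) (at t)"
      "\<And>t. \<bar>t\<bar> < d \<Longrightarrow> (y1 has_vector_derivative y2 t) (at t)"
      "\<And>t. \<bar>t\<bar> < d \<Longrightarrow> (y2 has_vector_derivative y3 t) (at t)"
  shows "\<exists>u2 u3. \<forall>t. \<bar>t\<bar> < d \<longrightarrow>
    DERIV (\<lambda>t. inner_L (x t) (y t)) t :> inner_L (x1 t) (y t) + inner_L (x t) (y1 t) \<and>
    DERIV (\<lambda>t. inner_L (x1 t) (y t) + inner_L (x t) (y1 t)) t :> u2 t \<and>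
    DERIV u2 t :> u3 t"
proof (rule exI, rule exI, intro allI impI conjI)
  fix t :: real assume t: "\<bar>t\<bar> < d"
  show "DERIV (\<lambda>t. inner_L (x t) (y t)) t :> inner_L (x1 t) (y t) + inner_L (x t) (y1 t)"
    by (intro DERIV_inner_L x y t)
  show "DERIV (\<lambda>t. inner_L (x1 t) (y t) + inner_L (x t) (y1 t)) t :>
      (inner_L (x2 t) (y t) + inner_L (x1 t) (y1 t)) + (inner_L (x1 t) (y1 t) + inner_L (x t) (y2 t))"
    by (intro DERIV_add DERIV_inner_L x y t)
  show "DERIV (\<lambda>t. (inner_L (x2 t) (y t) + inner_L (x1 t) (y1 t)) + (inner_L (x1 t) (y1 t) + inner_L (x t) (y2 t))) t :>
      ((inner_L (x3 t) (y t) + inner_L (x2 t) (y1 t)) + (inner_L (x2 t) (y1 t) + inner_L (x1 t) (y2 t))) +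
      ((inner_L (x2 t) (y1 t) + inner_L (x1 t) (y2 t)) + (inner_L (x1 t) (y2 t) + inner_L (x t) (y3 t)))"
    by (intro DERIV_add DERIV_inner_L x y t)
qed

section \<open>Asymptotics at the singular curve\<close>

context
  fixes I \<delta> \<Gamma> f s
  assumes edge: "generalized_cuspidal_edge I \<delta> \<Gamma> f" and s: "s \<in> I"
begin

lemma open_edge_domain: "open (strip I \<delta>)" and smooth_f: "smooth_on (strip I \<delta>) f" and singular_point_in_domain: "(s, 0) \<in> strip I \<delta>"
  and open_I: "open I" and \<delta>_pos: "\<delta> > 0"
  using edge s by (auto simp: generalized_cuspidal_edge_def open_strip) (auto simp: strip_def)

lemmas smooth_fs = smooth_on_ds[OF open_edge_domain smooth_f]
lemmas smooth_ft = smooth_on_dt[OF open_edge_domain smooth_f]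

lemma dt_eq_zero_on_edge: "(u, 0) \<in> strip I \<delta> \<Longrightarrow> dt f (u, 0) = 0"
  using edge by (auto simp: generalized_cuspidal_edge_def strip_def)

lemma tangent_eq_ds: "tangent \<Gamma> s = ds f (s, 0)"
proof -
  have "(\<Gamma> has_vector_derivative ds f (s, 0)) (at s)"
    by (rule has_vector_derivative_transform_within_open[OF has_vector_derivative_ds[OF smooth_f singular_point_in_domain] open_I s])
       (use edge in \<open>auto simp: generalized_cuspidal_edge_def\<close>)
  then show ?thesis unfolding tangent_def by (rule vector_derivative_at)
qed

lemma mixed_derivative_eq_zero: "dt (ds f) (s, 0) = 0"
proof -
  have "((\<lambda>u. dt f (u, 0)) has_vector_derivative 0) (at s)"
    by (rule has_vector_derivative_transform_within_open[OF has_vector_derivative_const[of 0] open_I s])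
       (use dt_eq_zero_on_edge \<delta>_pos in \<open>auto simp: strip_def\<close>)
  then have "ds (dt f) (s, 0) = 0"
    using vector_derivative_unique_at has_vector_derivative_ds[OF smooth_ft singular_point_in_domain] by blast
  then show ?thesis using mixed_partials_commute[OF open_edge_domain smooth_f singular_point_in_domain] by simp
qed

lemma tendsto_off_axis_smooth:
  "smooth_on (strip I \<delta>) h \<Longrightarrow> (h \<longlongrightarrow> h (s, 0)) (off_axis s)"
  using smooth_on_isCont[OF open_edge_domain _ singular_point_in_domain] isCont_def tendsto_within_subset by blast

lemmas lim_ft = quotient_tendsto_dt[OF open_edge_domain smooth_ft singular_point_in_domain dt_eq_zero_on_edge]
lemmas lim_ftt = second_quotient_tendsto_dt[OF open_edge_domain smooth_ft singular_point_in_domain dt_eq_zero_on_edge]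

lemma lim_E: "(E_L f \<longlongrightarrow> E_L f (s, 0)) (off_axis s)"
  unfolding E_L_def by (intro tendsto_intros tendsto_off_axis_smooth smooth_fs)

lemma lim_F: "((\<lambda>q. F_L f q / snd q) \<longlongrightarrow> inner_L (ds f (s, 0)) (dt (dt f) (s, 0))) (off_axis s)"
proof -
  have "F_L f q / snd q = inner_L (ds f q) (dt f q /\<^sub>R snd q)" for q
    by (simp add: F_L_def inner_L_scale divide_inverse)
  then show ?thesis using tendsto_inner_L[OF tendsto_off_axis_smooth[OF smooth_fs] lim_ft] by simp
qed

lemma lim_G: "((\<lambda>q. G_L f q / (snd q)\<^sup>2) \<longlongrightarrow> inner_L (dt (dt f) (s, 0)) (dt (dt f) (s, 0))) (off_axis s)"
proof -
  have "G_L f q / (snd q)\<^sup>2 = inner_L (dt f q /\<^sub>R snd q) (dt f q /\<^sub>R snd q)" for q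
    by (simp add: G_L_def inner_L_scale divide_inverse power2_eq_square)
  then show ?thesis using tendsto_inner_L[OF lim_ft lim_ft] by simp
qed

lemma lim_L: "(L_tilde f \<longlongrightarrow> 0) (off_axis s)"
proof -
  have "(L_tilde f \<longlongrightarrow> det3 (ds f (s, 0)) (dt f (s, 0)) (ds (ds f) (s, 0))) (off_axis s)"
    unfolding L_tilde_def
    by (intro tendsto_intros tendsto_off_axis_smooth smooth_fs smooth_ft smooth_on_ds[OF open_edge_domain smooth_fs])
  then show ?thesis by (simp add: dt_eq_zero_on_edge[OF singular_point_in_domain] det3_expand)
qed

lemma lim_M: "((\<lambda>q. M_tilde f q / snd q) \<longlongrightarrow> 0) (off_axis s)"
proof -
  have "M_tilde f q / snd q = det3 (ds f q) (dt f q /\<^sub>R snd q) (dt (ds f) q)" for q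
    by (simp add: M_tilde_def det3_scale divide_inverse)
  moreover have "((\<lambda>q. det3 (ds f q) (dt f q /\<^sub>R snd q) (dt (ds f) q))
      \<longlongrightarrow> det3 (ds f (s, 0)) (dt (dt f) (s, 0)) (dt (ds f) (s, 0))) (off_axis s)"
    by (intro tendsto_intros lim_ft tendsto_off_axis_smooth smooth_fs smooth_on_dt[OF open_edge_domain smooth_fs])
  ultimately show ?thesis by (simp add: mixed_derivative_eq_zero det3_expand)
qed

lemma lim_N: "((\<lambda>q. N_tilde f q / (snd q)\<^sup>2) \<longlongrightarrow>
    det3 (ds f (s, 0)) (dt (dt f) (s, 0)) (dt (dt (dt f)) (s, 0)) / 2) (off_axis s)"
proof -
  have "N_tilde f q / (snd q)\<^sup>2
    = det3 (ds f q) (dt f q /\<^sub>R snd q) ((dt (dt f) q - dt f q /\<^sub>R snd q) /\<^sub>R snd q)" for q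
    by (simp add: N_tilde_def det3_expand divide_inverse power2_eq_square algebra_simps)
  moreover have "((\<lambda>q. det3 (ds f q) (dt f q /\<^sub>R snd q) ((dt (dt f) q - dt f q /\<^sub>R snd q) /\<^sub>R snd q))
      \<longlongrightarrow> det3 (ds f (s, 0)) (dt (dt f) (s, 0)) (dt (dt (dt f)) (s, 0) /\<^sub>R 2)) (off_axis s)"
    by (intro tendsto_intros lim_ft lim_ftt tendsto_off_axis_smooth smooth_fs)
  ultimately show ?thesis by (simp add: det3_scale)
qed

text \<open>The \<open>t\<close>-derivatives of \<open>E\<close> and \<open>G\<close> vanish on the singular curve because \<open>f_st\<close> and \<open>f_t\<close> do. So if \<open>E\<close> and
  \<open>\<partial>\<^sub>t F = \<langle>f_s, f_tt\<rangle>\<close> vanish at \<open>(s, 0)\<close>, then \<open>E\<close>, \<open>F\<close> and \<open>G\<close> all vanish there to second order along \<open>t\<close>.\<close>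
lemma sing_order_ge_4:
  assumes "E_L f (s, 0) = 0" "inner_L (ds f (s, 0)) (dt (dt f) (s, 0)) = 0"
  shows "sing_order f s \<ge> 4"
proof -
  have S: "(s, t) \<in> strip I \<delta>" if "\<bar>t\<bar> < \<delta>" for t using that s by (auto simp: strip_def)
  note d = has_vector_derivative_dt[OF _ S]
  note sm = smooth_on_dt[OF open_edge_domain]
  note a = d[OF smooth_fs] d[OF sm[OF smooth_fs]] d[OF sm[OF sm[OF smooth_fs]]]
  note b = d[OF smooth_ft] d[OF sm[OF smooth_ft]] d[OF sm[OF sm[OF smooth_ft]]]
  obtain e2 e3 where E: "\<forall>t. \<bar>t\<bar> < \<delta> \<longrightarrow>
      DERIV (\<lambda>t. inner_L (ds f (s, t)) (ds f (s, t))) t :> inner_L (dt (ds f) (s, t)) (ds f (s, t)) + inner_L (ds f (s, t)) (dt (ds f) (s, t)) \<and>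
      DERIV (\<lambda>t. inner_L (dt (ds f) (s, t)) (ds f (s, t)) + inner_L (ds f (s, t)) (dt (ds f) (s, t))) t :> e2 t \<and>
      DERIV e2 t :> e3 t"
    using inner_L_three_derivatives[OF a a] by blast
  obtain \<phi>2 \<phi>3 where F: "\<forall>t. \<bar>t\<bar> < \<delta> \<longrightarrow>
      DERIV (\<lambda>t. inner_L (ds f (s, t)) (dt f (s, t))) t :> inner_L (dt (ds f) (s, t)) (dt f (s, t)) + inner_L (ds f (s, t)) (dt (dt f) (s, t)) \<and>
      DERIV (\<lambda>t. inner_L (dt (ds f) (s, t)) (dt f (s, t)) + inner_L (ds f (s, t)) (dt (dt f) (s, t))) t :> \<phi>2 t \<and>
      DERIV \<phi>2 t :> \<phi>3 t"
    using inner_L_three_derivatives[OF a b] by blast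
  obtain g2 g3 where G: "\<forall>t. \<bar>t\<bar> < \<delta> \<longrightarrow>
      DERIV (\<lambda>t. inner_L (dt f (s, t)) (dt f (s, t))) t :> inner_L (dt (dt f) (s, t)) (dt f (s, t)) + inner_L (dt f (s, t)) (dt (dt f) (s, t)) \<and>
      DERIV (\<lambda>t. inner_L (dt (dt f) (s, t)) (dt f (s, t)) + inner_L (dt f (s, t)) (dt (dt f) (s, t))) t :> g2 t \<and>
      DERIV g2 t :> g3 t"
    using inner_L_three_derivatives[OF b b] by blast
  have zero: "inner_L v 0 = 0" "inner_L 0 v = 0" for v by (simp_all add: inner_L_def)
  have "(deriv ^^ k) (\<lambda>t. Delta_L f (s, t)) 0 = 0" if "k < 4" for k
    unfolding Delta_L_def E_L_def F_L_def G_L_def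
    by (rule deriv_quadratic_expression_vanishes[OF \<delta>_pos E[rule_format] F[rule_format] G[rule_format]])
       (use assms that in \<open>simp_all add: E_L_def mixed_derivative_eq_zero dt_eq_zero_on_edge[OF singular_point_in_domain] zero\<close>)
  then have "enat k \<ge> 4" if "(deriv ^^ k) (\<lambda>t. Delta_L f (s, t)) 0 \<noteq> 0" for k
    using that by (metis enat_ord_simps(1) not_less numeral_eq_enat)
  then show ?thesis unfolding sing_order_def by (intro INF_greatest) auto
qed

section \<open>Accumulation of umbilical and quasi-umbilical points\<close>

text \<open>Points of the singular curve are not regular, so division by powers of \<open>t\<close> is allowed at every point of either type.\<close>
lemma umbilical_types_off_axis:
  assumes "q \<in> umbilical_points I \<delta> f \<union> quasi_umbilical_points I \<delta> f"
  shows "snd q \<noteq> 0" "Delta_L f q \<noteq> 0"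
    "(G_L f q * L_tilde f q - E_L f q * N_tilde f q)\<^sup>2 +
      4 * ((G_L f q * M_tilde f q - F_L f q * N_tilde f q) * (E_L f q * M_tilde f q - F_L f q * L_tilde f q)) = 0"
proof -
  have q: "q \<in> strip I \<delta>" "lin_indep2 (ds f q) (dt f q)" "inner_L (nu_L f q) (nu_L f q) \<noteq> 0"
    "is_singleton (principal_curvatures f q)"
    using assms by (auto simp: umbilical_points_def quasi_umbilical_points_def regular_point_def
        spacelike_point_def timelike_point_def spacelike_def timelike_def)
  show 1: "snd q \<noteq> 0"
  proof
    assume "snd q = 0"
    then have "dt f q = 0" using dt_eq_zero_on_edge q(1) by (metis prod.collapse)
    then have "0 *\<^sub>R ds f q + 1 *\<^sub>R dt f q = 0" by simp
    then show False using q(2) unfolding lin_indep2_def by (metis zero_neq_one)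
  qed
  then show 2: "Delta_L f q \<noteq> 0" using q(3) inner_L_nu_L by fastforce
  show "(G_L f q * L_tilde f q - E_L f q * N_tilde f q)\<^sup>2 +
      4 * ((G_L f q * M_tilde f q - F_L f q * N_tilde f q) * (E_L f q * M_tilde f q - F_L f q * L_tilde f q)) = 0"
    using q(4) is_singleton_principal_curvatures_iff[OF 2] by blast
qed

text \<open>The limit of the discriminant over \<open>t^4\<close> is \<open>(e n)^2\<close>.\<close>
lemma E_zero_if_umbilical_types_accumulate:
  assumes n: "det3 (ds f (s, 0)) (dt (dt f) (s, 0)) (dt (dt (dt f)) (s, 0)) \<noteq> 0"
    and lp: "(s, 0) islimpt X" and X: "X \<subseteq> umbilical_points I \<delta> f \<union> quasi_umbilical_points I \<delta> f"
  shows "E_L f (s, 0) = 0"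
proof -
  let ?E = "E_L f" and ?F = "\<lambda>q. F_L f q / snd q" and ?G = "\<lambda>q. G_L f q / (snd q)\<^sup>2"
    and ?L = "L_tilde f" and ?M = "\<lambda>q. M_tilde f q / snd q" and ?N = "\<lambda>q. N_tilde f q / (snd q)\<^sup>2"
  define n0 where "n0 = det3 (ds f (s, 0)) (dt (dt f) (s, 0)) (dt (dt (dt f)) (s, 0)) / 2"
  define \<phi> where "\<phi> = inner_L (ds f (s, 0)) (dt (dt f) (s, 0))"
  define \<gamma> where "\<gamma> = inner_L (dt (dt f) (s, 0)) (dt (dt f) (s, 0))"
  have le: "at (s, 0) within X \<le> off_axis s"
    using umbilical_types_off_axis(1) X by (intro at_le) auto
  have nontriv: "at (s, 0) within X \<noteq> bot" using lp by (simp add: trivial_limit_within)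
  have "((\<lambda>q. (?G q * ?L q - ?E q * ?N q)\<^sup>2 + 4 * ((?G q * ?M q - ?F q * ?N q) * (?E q * ?M q - ?F q * ?L q)))
    \<longlongrightarrow> (\<gamma> * 0 - ?E (s, 0) * n0)\<^sup>2 + 4 * ((\<gamma> * 0 - \<phi> * n0) * (?E (s, 0) * 0 - \<phi> * 0))) (off_axis s)"
    unfolding n0_def \<phi>_def \<gamma>_def
    by (intro tendsto_intros lim_E lim_F lim_G lim_L lim_M lim_N)
  then have "((\<lambda>q. (?G q * ?L q - ?E q * ?N q)\<^sup>2 + 4 * ((?G q * ?M q - ?F q * ?N q) * (?E q * ?M q - ?F q * ?L q)))
    \<longlongrightarrow> (?E (s, 0) * n0)\<^sup>2) (at (s, 0) within X)"
    using tendsto_mono[OF le] by simp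
  then have "((\<lambda>q. 0) \<longlongrightarrow> (?E (s, 0) * n0)\<^sup>2) (at (s, 0) within X)"
  proof (rule Lim_transform_eventually)
    show "\<forall>\<^sub>F q in at (s, 0) within X. (?G q * ?L q - ?E q * ?N q)\<^sup>2 +
        4 * ((?G q * ?M q - ?F q * ?N q) * (?E q * ?M q - ?F q * ?L q)) = 0"
      unfolding eventually_at_filter
    proof (intro always_eventually allI impI)
      fix q assume "q \<in> X"
      then have q: "q \<in> umbilical_points I \<delta> f \<union> quasi_umbilical_points I \<delta> f" using X by blast
      have t: "snd q \<noteq> 0" by (rule umbilical_types_off_axis(1)[OF q])
      have "?G q * ?L q - ?E q * ?N q = (G_L f q * L_tilde f q - E_L f q * N_tilde f q) / snd q ^ 2"
        by (simp add: diff_divide_distrib)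
      moreover have "?G q * ?M q - ?F q * ?N q = (G_L f q * M_tilde f q - F_L f q * N_tilde f q) / snd q ^ 3"
        by (simp add: diff_divide_distrib power2_eq_square power3_eq_cube)
      moreover have "?E q * ?M q - ?F q * ?L q = (E_L f q * M_tilde f q - F_L f q * L_tilde f q) / snd q"
        by (simp add: diff_divide_distrib)
      ultimately have "(?G q * ?L q - ?E q * ?N q)\<^sup>2 + 4 * ((?G q * ?M q - ?F q * ?N q) * (?E q * ?M q - ?F q * ?L q))
        = ((G_L f q * L_tilde f q - E_L f q * N_tilde f q) / snd q ^ 2)\<^sup>2 +
          4 * ((G_L f q * M_tilde f q - F_L f q * N_tilde f q) / snd q ^ 3 * ((E_L f q * M_tilde f q - F_L f q * L_tilde f q) / snd q))"
        by presburger
      also have "\<dots> = ((G_L f q * L_tilde f q - E_L f q * N_tilde f q)\<^sup>2 +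
          4 * ((G_L f q * M_tilde f q - F_L f q * N_tilde f q) * (E_L f q * M_tilde f q - F_L f q * L_tilde f q))) / snd q ^ 4"
        using t by (simp add: power_divide add_divide_distrib flip: power_mult power_Suc2)
      finally show "(?G q * ?L q - ?E q * ?N q)\<^sup>2 + 4 * ((?G q * ?M q - ?F q * ?N q) * (?E q * ?M q - ?F q * ?L q)) = 0"
        using umbilical_types_off_axis(3)[OF q] by simp
    qed
  qed
  from tendsto_unique[OF nontriv this tendsto_const] show ?thesis using n by (simp add: n0_def)
qed

text \<open>The upper right entry of \<open>W\<^sub>L\<close> is a multiple of \<open>G M - F N\<close>, and \<open>(G M - F N) / t^3\<close> tends to \<open>- \<phi> n\<close>.\<close>
lemma inner_zero_if_umbilical_accumulate:
  assumes n: "det3 (ds f (s, 0)) (dt (dt f) (s, 0)) (dt (dt (dt f)) (s, 0)) \<noteq> 0"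
    and lp: "(s, 0) islimpt umbilical_points I \<delta> f"
  shows "inner_L (ds f (s, 0)) (dt (dt f) (s, 0)) = 0"
proof -
  let ?X = "umbilical_points I \<delta> f"
  let ?F = "\<lambda>q. F_L f q / snd q" and ?G = "\<lambda>q. G_L f q / (snd q)\<^sup>2"
    and ?M = "\<lambda>q. M_tilde f q / snd q" and ?N = "\<lambda>q. N_tilde f q / (snd q)\<^sup>2"
  define n0 where "n0 = det3 (ds f (s, 0)) (dt (dt f) (s, 0)) (dt (dt (dt f)) (s, 0)) / 2"
  define \<phi> where "\<phi> = inner_L (ds f (s, 0)) (dt (dt f) (s, 0))"
  define \<gamma> where "\<gamma> = inner_L (dt (dt f) (s, 0)) (dt (dt f) (s, 0))"
  have le: "at (s, 0) within ?X \<le> off_axis s"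
    using umbilical_types_off_axis(1) by (intro at_le) auto
  have nontriv: "at (s, 0) within ?X \<noteq> bot" using lp by (simp add: trivial_limit_within)
  have "((\<lambda>q. ?G q * ?M q - ?F q * ?N q) \<longlongrightarrow> \<gamma> * 0 - \<phi> * n0) (off_axis s)"
    unfolding n0_def \<phi>_def \<gamma>_def by (intro tendsto_intros lim_F lim_G lim_M lim_N)
  then have "((\<lambda>q. ?G q * ?M q - ?F q * ?N q) \<longlongrightarrow> - (\<phi> * n0)) (at (s, 0) within ?X)"
    using tendsto_mono[OF le] by simp
  then have "((\<lambda>q. 0) \<longlongrightarrow> - (\<phi> * n0)) (at (s, 0) within ?X)"
  proof (rule Lim_transform_eventually)
    show "\<forall>\<^sub>F q in at (s, 0) within ?X. ?G q * ?M q - ?F q * ?N q = 0"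
      unfolding eventually_at_filter
    proof (intro always_eventually allI impI)
      fix q assume q: "q \<in> ?X"
      have t: "snd q \<noteq> 0" and D: "Delta_L f q \<noteq> 0" using umbilical_types_off_axis[of q] q by auto
      have "W_L f q $ 1 $ 2 = 0" using q by (simp add: umbilical_points_def)
      then have "G_L f q * M_tilde f q - F_L f q * N_tilde f q = 0"
        unfolding W_L_entries using D by simp
      moreover have "?G q * ?M q - ?F q * ?N q = (G_L f q * M_tilde f q - F_L f q * N_tilde f q) / snd q ^ 3"
        by (simp add: diff_divide_distrib power2_eq_square power3_eq_cube)
      ultimately show "?G q * ?M q - ?F q * ?N q = 0" by simp
    qed
  qed
  from tendsto_unique[OF nontriv this tendsto_const] show ?thesis using n by (simp add: n0_def \<phi>_def)
qed

end

lemma cuspidal_edge_no_accumulation: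
  assumes "cuspidal_edge I \<delta> \<Gamma> f" "s \<in> I" "sing_order f s < 4"
  shows "\<not> (s, 0) islimpt umbilical_points I \<delta> f"
    and "\<not> lightlike_curve_point \<Gamma> s \<Longrightarrow> \<not> (s, 0) islimpt quasi_umbilical_points I \<delta> f"
proof -
  have edge: "generalized_cuspidal_edge I \<delta> \<Gamma> f" using assms by (simp add: cuspidal_edge_def)
  note loc = edge assms(2)
  have n: "det3 (ds f (s, 0)) (dt (dt f) (s, 0)) (dt (dt (dt f)) (s, 0)) \<noteq> 0"
    by (rule cuspidal_edge_singular_point_nondegenerate[OF open_edge_domain[OF loc] smooth_f[OF loc] singular_point_in_domain[OF loc]
          dt_eq_zero_on_edge[OF loc singular_point_in_domain[OF loc]]])
       (use assms in \<open>auto simp: cuspidal_edge_def\<close>)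
  show "\<not> (s, 0) islimpt umbilical_points I \<delta> f"
    using sing_order_ge_4[OF loc] E_zero_if_umbilical_types_accumulate[OF loc n] inner_zero_if_umbilical_accumulate[OF loc n]
      assms(3) by fastforce
  show "\<not> (s, 0) islimpt quasi_umbilical_points I \<delta> f" if "\<not> lightlike_curve_point \<Gamma> s"
  proof
    assume "(s, 0) islimpt quasi_umbilical_points I \<delta> f"
    then have "E_L f (s, 0) = 0" using E_zero_if_umbilical_types_accumulate[OF loc n] by auto
    then show False
      using that edge assms(2)
      by (auto simp: lightlike_curve_point_def lightlike_def tangent_eq_ds[OF loc] E_L_def generalized_cuspidal_edge_def)
  qed
qed

section \<open>A cuspidal edge on which quasi-umbilical points accumulate\<close>

text \<open>The transversal part \<open>(0, t\<^sup>3 / 3, t\<^sup>2 / 2)\<close> is chosen so that \<open>\<langle>\<Gamma>', f_tt\<rangle> = - 1\<close> on the edge, which keeps the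
  order equal to 2, and so that \<open>\<Gamma>''\<close> is transversal to the plane of \<open>\<Gamma>'\<close> and \<open>f_tt\<close>, which makes the linear
  coefficient of the discriminant in \<open>t\<close> non-zero at the origin.\<close>
definition cusp_example :: "real \<times> real \<Rightarrow> real^3" where
  "cusp_example = (\<lambda>(s, t). vector [s, s\<^sup>2 / 2 + t ^ 3 / 3, s + t\<^sup>2 / 2])"

lemma smooth_on_fst: "open S \<Longrightarrow> smooth_on S (fst :: real \<times> real \<Rightarrow> real)"
  and smooth_on_snd: "open S \<Longrightarrow> smooth_on S (snd :: real \<times> real \<Rightarrow> real)"
  by (simp_all add: smooth_on_bounded_linear bounded_linear_fst bounded_linear_snd)

lemma smooth_on_nth: "open S \<Longrightarrow> smooth_on S (\<lambda>x. (x :: real^3) $ i)"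
  by (simp add: smooth_on_bounded_linear bounded_linear_vec_nth)

lemma smooth_cusp_example:
  assumes "open S"
  shows "smooth_on S cusp_example"
proof -
  have "smooth_on S (\<lambda>p. vector [fst p, fst p * fst p * (1/2) + snd p * snd p * snd p * (1/3),
      fst p + snd p * snd p * (1/2)] :: real^3)"
    by (intro smooth_on_vector_3 smooth_on_add smooth_on_mult smooth_on_fst smooth_on_snd smooth_on_const assms)
  then show ?thesis
    by (simp add: cusp_example_def case_prod_unfold power2_eq_square power3_eq_cube)
qed

lemma ds_vector_3:
  assumes "\<And>s t. ((\<lambda>s. a (s, t)) has_real_derivative a' (s, t)) (at s)"
    "\<And>s t. ((\<lambda>s. b (s, t)) has_real_derivative b' (s, t)) (at s)"
    "\<And>s t. ((\<lambda>s. c (s, t)) has_real_derivative c' (s, t)) (at s)"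
  shows "ds (\<lambda>p. vector [a p, b p, c p]) = (\<lambda>p. vector [a' p, b' p, c' p])"
  unfolding ds_def
  using assms unfolding has_real_derivative_iff_has_vector_derivative
  by (auto intro!: ext vector_derivative_at has_vector_derivative_vector_3)

lemma dt_vector_3:
  assumes "\<And>s t. ((\<lambda>t. a (s, t)) has_real_derivative a' (s, t)) (at t)"
    "\<And>s t. ((\<lambda>t. b (s, t)) has_real_derivative b' (s, t)) (at t)"
    "\<And>s t. ((\<lambda>t. c (s, t)) has_real_derivative c' (s, t)) (at t)"
  shows "dt (\<lambda>p. vector [a p, b p, c p]) = (\<lambda>p. vector [a' p, b' p, c' p])"
  unfolding dt_def
  using assms unfolding has_real_derivative_iff_has_vector_derivative
  by (auto intro!: ext vector_derivative_at has_vector_derivative_vector_3)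

lemma cusp_example_derivatives:
  shows "ds cusp_example = (\<lambda>p. vector [1, fst p, 1])"
    and "dt cusp_example = (\<lambda>p. vector [0, (snd p)\<^sup>2, snd p])"
    and "ds (\<lambda>p. vector [1, fst p, 1]) = (\<lambda>p. vector [0, 1, 0])"
    and "dt (\<lambda>p. vector [1, fst p, 1]) = (\<lambda>p. vector [0, 0, 0])"
    and "dt (\<lambda>p. vector [0, (snd p)\<^sup>2, snd p]) = (\<lambda>p. vector [0, 2 * snd p, 1])"
proof -
  have f: "cusp_example = (\<lambda>p. vector [fst p, (fst p)\<^sup>2 / 2 + snd p ^ 3 / 3, fst p + (snd p)\<^sup>2 / 2])"
    by (simp add: cusp_example_def case_prod_unfold)
  show "ds cusp_example = (\<lambda>p. vector [1, fst p, 1])"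
    unfolding f by (rule ds_vector_3) (auto intro!: derivative_eq_intros)
  show "dt cusp_example = (\<lambda>p. vector [0, (snd p)\<^sup>2, snd p])"
    unfolding f by (rule dt_vector_3) (auto intro!: derivative_eq_intros)
  show "ds (\<lambda>p. vector [1, fst p, 1]) = (\<lambda>p. vector [0, 1, 0])"
    by (rule ds_vector_3) (auto intro!: derivative_eq_intros)
  show "dt (\<lambda>p. vector [1, fst p, 1]) = (\<lambda>p. vector [0, 0, 0])"
    by (rule dt_vector_3) (auto intro!: derivative_eq_intros)
  show "dt (\<lambda>p. vector [0, (snd p)\<^sup>2, snd p]) = (\<lambda>p. vector [0, 2 * snd p, 1])"
    by (rule dt_vector_3) (auto intro!: derivative_eq_intros)
qed

lemma tangent_cusp_example: "tangent (\<lambda>s. cusp_example (s, 0)) s = vector [1, s, 1]"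
  using cusp_example_derivatives(1)[THEN fun_cong, of "(s, 0)"] by (simp add: tangent_def ds_def)

lemma generalized_cuspidal_edge_example:
  "generalized_cuspidal_edge UNIV 1 (\<lambda>s. cusp_example (s, 0)) cusp_example"
  by (auto simp: generalized_cuspidal_edge_def smooth_cusp_example open_strip tangent_cusp_example
      cusp_example_derivatives lin_indep2_def vec_eq_iff forall_3)

text \<open>Eliminating \<open>s\<close> from the last two coordinates by means of the first straightens the example globally to the standard cusp.\<close>
lemma cuspidal_edge_example: "cuspidal_edge UNIV 1 (\<lambda>s. cusp_example (s, 0)) cusp_example"
  unfolding cuspidal_edge_def
proof (intro conjI ballI generalized_cuspidal_edge_example)
  fix s0 :: real
  define S where "S = strip UNIV 1"
  have oS: "open S" by (simp add: S_def open_strip)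
  define \<phi> where "\<phi> = (\<lambda>p :: real \<times> real. p + (- s0, 0))"
  define \<Psi> where "\<Psi> = (\<lambda>x :: real^3. vector [x$1 - s0, 2 * (x$3 - x$1), 3 * (x$2 - x$1 * x$1 / 2)] :: real^3)"
  define \<Psi>' where "\<Psi>' = (\<lambda>x :: real^3. vector [x$1 + s0, x$3 / 3 + (x$1 + s0) * (x$1 + s0) / 2, x$2 / 2 + (x$1 + s0)] :: real^3)"
  have trans: "smooth_on S (\<lambda>p. p + (c, 0))" for c :: real
    by (intro smooth_on_add smooth_on_const smooth_on_bounded_linear bounded_linear_ident oS)
  have "homeomorphism S S \<phi> (\<lambda>p. p + (s0, 0))"
    unfolding \<phi>_def
    by (rule homeomorphismI)
       (auto simp: S_def strip_def zero_prod_def[symmetric] intro!: continuous_on_add continuous_on_id continuous_on_const)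
  then have \<phi>: "diffeo_on S S \<phi>"
    unfolding diffeo_on_def using oS trans \<phi>_def by blast
  have s\<Psi>: "smooth_on UNIV \<Psi>"
  proof -
    have "smooth_on UNIV (\<lambda>x :: real^3. vector [x$1 + (- s0), 2 * (x$3 + (-1) * x$1), 3 * (x$2 + (-1/2) * (x$1 * x$1))] :: real^3)"
      by (intro smooth_on_vector_3 smooth_on_add smooth_on_mult smooth_on_nth smooth_on_const open_UNIV)
    then show ?thesis by (simp add: \<Psi>_def)
  qed
  have s\<Psi>': "smooth_on UNIV \<Psi>'"
  proof -
    have "smooth_on UNIV (\<lambda>x :: real^3. vector [x$1 + s0, (1/3) * x$3 + (1/2) * ((x$1 + s0) * (x$1 + s0)), (1/2) * x$2 + (x$1 + s0)] :: real^3)"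
      by (intro smooth_on_vector_3 smooth_on_add smooth_on_mult smooth_on_nth smooth_on_const open_UNIV)
    then show ?thesis by (simp add: \<Psi>'_def)
  qed
  have inv: "\<Psi>' (\<Psi> x) = x" "\<Psi> (\<Psi>' x) = x" for x
    by (simp_all add: \<Psi>_def \<Psi>'_def vec_eq_iff forall_3 field_simps)
  have "homeomorphism UNIV UNIV \<Psi> \<Psi>'"
    using smooth_on_imp_continuous_on[OF s\<Psi>] smooth_on_imp_continuous_on[OF s\<Psi>'] inv
    by (intro homeomorphismI) auto
  then have \<Psi>: "diffeo_on UNIV UNIV \<Psi>"
    unfolding diffeo_on_def using s\<Psi> s\<Psi>' by blast
  show "cuspidal_edge_singular_point UNIV 1 cusp_example (s0, 0)"
    unfolding cuspidal_edge_singular_point_def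
  proof (intro exI conjI)
    show "diffeo_on S S \<phi>" by (rule \<phi>)
    show "diffeo_on UNIV UNIV \<Psi>" by (rule \<Psi>)
    show "(s0, 0) \<in> S" "S \<subseteq> strip UNIV 1" by (auto simp: S_def strip_def)
    show "\<forall>q\<in>S. \<Psi> (cusp_example q) = standard_cusp (\<phi> q)"
      by (auto simp: \<Psi>_def \<phi>_def cusp_example_def standard_cusp_def vec_eq_iff forall_3 power2_eq_square)
    show "\<Psi> (cusp_example (s0, 0)) = 0"
      by (simp add: \<Psi>_def cusp_example_def vec_eq_iff forall_3 power2_eq_square)
  qed (auto simp: \<phi>_def)
qed

lemma sing_order_example: "sing_order cusp_example 0 < 4"
proof -
  have D: "(\<lambda>t. Delta_L cusp_example (0, t)) = (\<lambda>t. - (t\<^sup>2))"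
    by (simp add: Delta_L_def E_L_def F_L_def G_L_def inner_L_def cusp_example_derivatives)
  have "deriv (\<lambda>t :: real. - (t\<^sup>2)) = (\<lambda>t. - 2 * t)"
    by (rule ext, rule DERIV_imp_deriv) (auto intro!: derivative_eq_intros)
  moreover have "deriv (\<lambda>t :: real. - 2 * t) = (\<lambda>t. - 2)"
    by (rule ext, rule DERIV_imp_deriv) (auto intro!: derivative_eq_intros)
  ultimately have "(deriv ^^ 2) (\<lambda>t. Delta_L cusp_example (0, t)) 0 \<noteq> 0"
    unfolding D by (simp add: numeral_2_eq_2)
  then have "sing_order cusp_example 0 \<le> enat 2"
    unfolding sing_order_def by (intro INF_lower) simp
  also have "enat 2 < 4" by (simp add: numeral_eq_enat)
  finally show ?thesis .
qed

lemma isolated_lightlike_example: "isolated_lightlike_curve_point UNIV (\<lambda>s. cusp_example (s, 0)) 0"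
proof -
  have "lightlike_curve_point (\<lambda>s. cusp_example (s, 0)) s \<longleftrightarrow> s = 0" for s
    by (auto simp: lightlike_curve_point_def lightlike_def tangent_cusp_example inner_L_def vec_eq_iff forall_3)
  then have "{u \<in> UNIV. lightlike_curve_point (\<lambda>s. cusp_example (s, 0)) u} = {0}" 
    "lightlike_curve_point (\<lambda>s. cusp_example (s, 0)) 0" by auto
  then show ?thesis unfolding isolated_lightlike_curve_point_def by (simp add: islimpt_finite)
qed

lemma equal_principal_curvatures_example:
  assumes "snd q \<noteq> 0" "\<bar>snd q\<bar> < 1"
    and "(snd q - snd q ^ 3 + (fst q)\<^sup>2)\<^sup>2 + 4 * snd q * (fst q * snd q - 1)\<^sup>2 = 0"
  shows "q \<in> umbilical_points UNIV 1 cusp_example \<union> quasi_umbilical_points UNIV 1 cusp_example"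
proof -
  obtain s t where q: "q = (s, t)" by fastforce
  have t: "t \<noteq> 0" "\<bar>t\<bar> < 1" and z: "(t - t ^ 3 + s\<^sup>2)\<^sup>2 + 4 * t * (s * t - 1)\<^sup>2 = 0"
    using assms by (simp_all add: q)
  have "t\<^sup>2 < 1" using t(2) by (simp add: abs_square_less_1)
  have \<nu>: "inner_L (nu_L cusp_example q) (nu_L cusp_example q) = (s - t)\<^sup>2 + 1 - t\<^sup>2"
    using t unfolding q
    by (simp add: nu_L_def inner_L_cross_L inner_L_scale cusp_example_derivatives)
       (simp add: inner_L_def field_simps power2_eq_square)
  then have pos: "inner_L (nu_L cusp_example q) (nu_L cusp_example q) > 0"
    using \<open>t\<^sup>2 < 1\<close> by (simp add: add_nonneg_pos add_diff_eq[symmetric])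
  have D: "Delta_L cusp_example q \<noteq> 0"
    using pos inner_L_nu_L[of q cusp_example] assms(1) by auto
  have "(G_L cusp_example q * L_tilde cusp_example q - E_L cusp_example q * N_tilde cusp_example q)\<^sup>2 +
      4 * ((G_L cusp_example q * M_tilde cusp_example q - F_L cusp_example q * N_tilde cusp_example q) *
        (E_L cusp_example q * M_tilde cusp_example q - F_L cusp_example q * L_tilde cusp_example q))
     = t ^ 4 * ((t - t ^ 3 + s\<^sup>2)\<^sup>2 + 4 * t * (s * t - 1)\<^sup>2)"
    unfolding q
    by (simp add: E_L_def F_L_def G_L_def L_tilde_def M_tilde_def N_tilde_def inner_L_def det3_expand
        cusp_example_derivatives) algebra
  then have sing: "is_singleton (principal_curvatures cusp_example q)"
    using z is_singleton_principal_curvatures_iff[OF D] by simp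
  have "regular_point cusp_example q"
    using t by (auto simp: regular_point_def lin_indep2_def cusp_example_derivatives vec_eq_iff forall_3 q)
  moreover have "timelike_point cusp_example q"
    using pos by (auto simp: timelike_point_def spacelike_def inner_L_def)
  moreover have "q \<in> strip UNIV 1" using t by (auto simp: strip_def q)
  ultimately show ?thesis
    using sing by (auto simp: umbilical_points_def quasi_umbilical_points_def)
qed

text \<open>For small \<open>s > 0\<close> the intermediate value theorem on the segment between \<open>t = - s\<^sup>2\<close> and \<open>t = 0\<close> yields a zero of the
  discriminant. Which of the two types occurs is settled by the non-accumulation of umbilical points.\<close>
lemma quasi_umbilical_points_accumulate_example:
  "(0, 0) islimpt quasi_umbilical_points UNIV 1 cusp_example"
proof -
  let ?X = "umbilical_points UNIV 1 cusp_example \<union> quasi_umbilical_points UNIV 1 cusp_example"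
  have "(0, 0) islimpt ?X"
    unfolding islimpt_approachable
  proof (intro allI impI)
    fix e :: real assume "e > 0"
    define s where "s = min (e / 2) (1 / 2)"
    have s: "0 < s" "s \<le> e / 2" "s \<le> 1 / 2" using \<open>e > 0\<close> by (auto simp: s_def)
    have s2: "s\<^sup>2 \<le> s / 2" "s\<^sup>2 \<le> 1 / 4"
      using s mult_left_mono[of s "1/2" s] mult_mono[of s "1/2" s "1/2"] by (auto simp: power2_eq_square)
    define h where "h t = (t - t ^ 3 + s\<^sup>2)\<^sup>2 + 4 * t * (s * t - 1)\<^sup>2" for t
    have h0: "h 0 > 0" using s by (simp add: h_def)
    have "h (- (s\<^sup>2)) = (s\<^sup>2) * (s ^ 10 - 4 * (1 + s ^ 3)\<^sup>2)"
      by (simp add: h_def) algebra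
    moreover have "s ^ 10 - 4 * (1 + s ^ 3)\<^sup>2 < 0"
    proof -
      have "s ^ 10 \<le> 1" using s by (intro power_le_one) auto
      moreover have "(1 + s ^ 3)\<^sup>2 \<ge> 1" using s by (intro one_le_power) auto
      ultimately show ?thesis by linarith
    qed
    ultimately have h1: "h (- (s\<^sup>2)) < 0" using s by (simp add: mult_pos_neg)
    have "continuous_on {- (s\<^sup>2)..0} h" unfolding h_def by (intro continuous_intros)
    then obtain t where t: "- (s\<^sup>2) \<le> t" "t \<le> 0" "h t = 0"
      using IVT'[of h "- (s\<^sup>2)" 0 0] h0 h1 by auto
    have "t \<noteq> 0" using t h0 by auto
    have "(s, t) \<in> ?X"
      by (rule equal_principal_curvatures_example) (use t \<open>t \<noteq> 0\<close> s2 in \<open>auto simp: h_def\<close>)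
    moreover have "dist (s, t) (0, 0) < e"
    proof -
      have "dist (s, t) (0, 0) \<le> \<bar>s\<bar> + \<bar>t\<bar>"
        using norm_Pair_le[of s t] by (simp add: dist_norm)
      also have "\<dots> < e" using s s2 t by linarith
      finally show ?thesis .
    qed
    ultimately show "\<exists>x'\<in>?X. x' \<noteq> (0, 0) \<and> dist x' (0, 0) < e" using s by (intro bexI[of _ "(s, t)"]) auto
  qed
  moreover have "\<not> (0, 0) islimpt umbilical_points UNIV 1 cusp_example"
    by (rule cuspidal_edge_no_accumulation(1)[OF cuspidal_edge_example _ sing_order_example]) simp
  ultimately show ?thesis by (simp add: islimpt_Un)
qed

theorem propositionE:
  shows "(\<forall>I \<delta> \<Gamma> f s.
            cuspidal_edge I \<delta> \<Gamma> f \<and> s \<in> I \<and> sing_order f s < 4 \<longrightarrow>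
              \<not> (s, 0) islimpt umbilical_points I \<delta> f \<and>
              (\<not> lightlike_curve_point \<Gamma> s \<longrightarrow>
                 \<not> (s, 0) islimpt quasi_umbilical_points I \<delta> f)) \<and>
         (\<exists>I \<delta> \<Gamma> f s.
            cuspidal_edge I \<delta> \<Gamma> f \<and> s \<in> I \<and> sing_order f s < 4 \<and>
            isolated_lightlike_curve_point I \<Gamma> s \<and>
            (s, 0) islimpt quasi_umbilical_points I \<delta> f)"
proof (rule conjI)
  show "\<exists>I \<delta> \<Gamma> f s.
            cuspidal_edge I \<delta> \<Gamma> f \<and> s \<in> I \<and> sing_order f s < 4 \<and>
            isolated_lightlike_curve_point I \<Gamma> s \<and>
            (s, 0) islimpt quasi_umbilical_points I \<delta> f"
    using cuspidal_edge_example sing_order_example isolated_lightlike_example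
      quasi_umbilical_points_accumulate_example by blast
qed (use cuspidal_edge_no_accumulation in blast)

end
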